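(* Let $E/\mathbb Q(t)$ be the elliptic curve $y^2=x^3-(t^2+27)x+10t^2+48t+90$, and let $M\le E(\mathbb Q(t))$ be the subgroup generated by $P=(t+3,4t+6)$ and $Q=(9,t+24)$. Let $t_0\in\mathbb Q$ be such that $E_{t_0}$ is an elliptic curve, $t_0\notin\{-26,-19,-12,-11,-5,-3,-1,6,9,44\}$, and the polynomial $x^3-(t_0^2+27)x+10t_0^2+48t_0+90$ has no rational roots. Then the restricted specialization map $\sigma_{t_0}|_M:M\to E_{t_0}(\mathbb Q)$ is injective.
   Context: $E_{t_0}$ denotes the curve $y^2=x^3-(t_0^2+27)x+10t_0^2+48t_0+90$ over $\mathbb Q$, and $\sigma_{t_0}:E(\mathbb Q(t))\to E_{t_0}(\mathbb Q)$ is the specialization homomorphism $(x(t),y(t))\mapsto(x(t_0),y(t_0))$, $O\mapsto O$. *)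

theory Defs
  imports "HOL-Computational_Algebra.Polynomial_Factorial"
          "HOL-Computational_Algebra.Field_as_Ring"
          "HOL-Computational_Algebra.Normalized_Fraction"
          "HOL-Algebra.Generated_Groups"
begin

datatype 'a ecpt = Infty | Pt 'a 'a

definition on_curve :: "'a::field \<Rightarrow> 'a \<Rightarrow> 'a ecpt \<Rightarrow> bool" where
  "on_curve a b P = (case P of Infty \<Rightarrow> True | Pt x y \<Rightarrow> y^2 = x^3 + a*x + b)"

definition ec_points :: "'a::field \<Rightarrow> 'a \<Rightarrow> 'a ecpt set" where
  "ec_points a b = {P. on_curve a b P}"

definition nonsingular :: "'a::field \<Rightarrow> 'a \<Rightarrow> bool" where
  "nonsingular a b = (4 * a^3 + 27 * b^2 \<noteq> 0)"

text \<open>Chord-and-tangent addition (characteristic not 2 or 3).\<close>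
fun ec_add :: "'a::field \<Rightarrow> 'a ecpt \<Rightarrow> 'a ecpt \<Rightarrow> 'a ecpt" where
  "ec_add a Infty P = P"
| "ec_add a P Infty = P"
| "ec_add a (Pt x1 y1) (Pt x2 y2) =
     (if x1 = x2 \<and> y1 = - y2 then Infty
      else (let l = (if x1 = x2 then (3 * x1^2 + a) / (2 * y1) else (y2 - y1) / (x2 - x1));
                x3 = l^2 - x1 - x2
            in Pt x3 (l * (x1 - x3) - y1)))"

definition ec_group :: "'a::field \<Rightarrow> 'a \<Rightarrow> 'a ecpt monoid" where
  "ec_group a b = \<lparr>carrier = ec_points a b, mult = ec_add a, one = Infty\<rparr>"

type_synonym ratfun = "rat poly fract"

definition rf :: "rat poly \<Rightarrow> ratfun" where
  "rf p = to_fract p"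

definition EA :: ratfun where "EA = rf [:-27, 0, -1:]"
definition EB :: ratfun where "EB = rf [:90, 48, 10:]"

definition E_group :: "ratfun ecpt monoid" where
  "E_group = ec_group EA EB"

definition P_pt :: "ratfun ecpt" where "P_pt = Pt (rf [:3, 1:]) (rf [:6, 4:])"
definition Q_pt :: "ratfun ecpt" where "Q_pt = Pt (rf [:9:]) (rf [:24, 1:])"

definition M_sub :: "ratfun ecpt set" where
  "M_sub = generate E_group {P_pt, Q_pt}"

definition EA0 :: "rat \<Rightarrow> rat" where "EA0 t0 = - (t0^2 + 27)"
definition EB0 :: "rat \<Rightarrow> rat" where "EB0 t0 = 10 * t0^2 + 48 * t0 + 90"

text \<open>A rational function (in lowest terms p/q) has a pole at t0 iff q(t0) = 0;
  otherwise its value at t0 is p(t0)/q(t0).\<close>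
definition has_pole :: "ratfun \<Rightarrow> rat \<Rightarrow> bool" where
  "has_pole f t0 = (poly (snd (quot_of_fract f)) t0 = 0)"

definition rf_eval :: "ratfun \<Rightarrow> rat \<Rightarrow> rat" where
  "rf_eval f t0 = (case quot_of_fract f of (p, q) \<Rightarrow> poly p t0 / poly q t0)"

text \<open>Specialization sigma_{t0}: (x(t),y(t)) \<mapsto> (x(t0),y(t0)), O \<mapsto> O.
  When x(t) has a pole at t0 (so that the point meets the zero section of
  the fibre) the image is O, the standard convention.\<close>
definition spec :: "rat \<Rightarrow> ratfun ecpt \<Rightarrow> rat ecpt" where
  "spec t0 P = (case P of Infty \<Rightarrow> Infty
     | Pt x y \<Rightarrow> (if has_pole x t0 \<or> has_pole y t0 then Infty
                  else Pt (rf_eval x t0) (rf_eval y t0)))"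

end

theory Submission
  imports Defs
    "HOL-Computational_Algebra.Squarefree"
    "HOL-Computational_Algebra.Nth_Powers"
begin

text \<open>
  Specialization is a homomorphism, so it suffices that \<open>i P\<^sub>0 + j Q\<^sub>0 = O\<close> in \<open>E\<^sub>t\<^sub>0(\<rat>)\<close> forces \<open>i = j = 0\<close>. As there
  is no rational 2-torsion, a nontrivial relation can be halved until it is odd, and then one of
  \<open>P\<^sub>0\<close>, \<open>Q\<^sub>0\<close>, \<open>P\<^sub>0 + Q\<^sub>0\<close> is twice a rational point. The slope \<open>m\<close> of the tangent at the half point satisfies
  a quartic equation over \<open>\<rat>(t\<^sub>0)\<close> which is quadratic in \<open>t\<^sub>0\<close>; its discriminant gives a rational point on
  \<open>s\<^sup>2 = 8m(m+2)(m+3)(m+7)\<close>, \<open>s\<^sup>2 = -(m+1)(m+3)(m+5)(m-9)\<close> or \<open>s\<^sup>2 = 8m(m+2)(m-3)(m-5)\<close>, respectively.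
  These curves are isomorphic to \<open>y\<^sup>2 = x(x+16)(x+30)\<close>, \<open>y\<^sup>2 = x(x+7)(x+12)\<close> and \<open>y\<^sup>2 = x(x+8)(x+50)\<close>. For
  each of them a full 2-descent leaves only the classes of the four 2-torsion points, and Fermat's
  infinite descent on the system \<open>b\<^sup>2 = a\<^sup>2 + p c\<^sup>2\<close>, \<open>d\<^sup>2 = b\<^sup>2 + q c\<^sup>2\<close> shows that there are no other
  rational points. So \<open>s = 0\<close>, and the roots \<open>m\<close> give exactly the excluded values of \<open>t\<^sub>0\<close>.
\<close>

section \<open>The group law\<close>

fun ec_neg :: "'a::field ecpt \<Rightarrow> 'a ecpt" where
  "ec_neg Infty = Infty"
| "ec_neg (Pt x y) = Pt x (- y)"

lemma ec_neg_neg [simp]: "ec_neg (ec_neg A) = A"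
  by (cases A) auto

lemma ec_add_Infty_right [simp]: "ec_add a A Infty = A"
  by (cases A) auto

lemma ec_add_neg_right [simp]: "ec_add a A (ec_neg A) = Infty"
  by (cases A) auto

lemma ec_add_neg_left [simp]: "ec_add a (ec_neg A) A = Infty"
  by (cases A) auto

lemma ec_add_eq_Infty_iff: "ec_add a A B = Infty \<longleftrightarrow> B = ec_neg A"
  by (cases A; cases B) (auto simp: Let_def split: if_splits)

text \<open>A division-free form of the slope, so that chord and tangent are treated together: the
  second equation is the difference of the two curve equations divided by \<open>x1 - x2\<close>,
  and for equal points it is the tangent condition.\<close>

definition is_slope :: "'a::field \<Rightarrow> 'a \<Rightarrow> 'a \<Rightarrow> 'a \<Rightarrow> 'a \<Rightarrow> 'a \<Rightarrow> bool" where
  "is_slope a l x1 y1 x2 y2 \<longleftrightarrow>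
     l * (x1 - x2) = y1 - y2 \<and> l * (y1 + y2) = x1^2 + x1 * x2 + x2^2 + a"

locale elliptic_curve =
  fixes a b :: "'a::field"
  assumes nonsingular: "nonsingular a b" and two_nonzero: "(2::'a) \<noteq> 0"
begin

abbreviation on :: "'a ecpt \<Rightarrow> bool" where "on \<equiv> on_curve a b"
abbreviation add (infixl "\<boxplus>" 65) where "A \<boxplus> B \<equiv> ec_add a A B"

lemma on_Infty [simp]: "on Infty"
  by (simp add: on_curve_def)

lemma on_Pt: "on (Pt x y) \<longleftrightarrow> y^2 = x^3 + a * x + b"
  by (simp add: on_curve_def)

lemma on_neg [simp]: "on (ec_neg A) \<longleftrightarrow> on A"
  by (cases A) (auto simp: on_curve_def)

lemma slope_unique:
  assumes "is_slope a l x1 y1 x2 y2" "is_slope a m x1 y1 x2 y2" "\<not> (x1 = x2 \<and> y1 = - y2)"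
  shows "l = m"
proof (cases "x1 = x2")
  case True
  then have "y1 + y2 \<noteq> 0" using assms(3) by (simp add: eq_neg_iff_add_eq_0)
  moreover have "l * (y1 + y2) = m * (y1 + y2)" using assms by (simp add: is_slope_def)
  ultimately show ?thesis by simp
next
  case False
  moreover have "l * (x1 - x2) = m * (x1 - x2)" using assms by (simp add: is_slope_def)
  ultimately show ?thesis by simp
qed

lemma add_slopeE:
  assumes "on (Pt x1 y1)" "on (Pt x2 y2)" "\<not> (x1 = x2 \<and> y1 = - y2)"
  obtains l where "is_slope a l x1 y1 x2 y2"
    "Pt x1 y1 \<boxplus> Pt x2 y2 = Pt (l^2 - x1 - x2) (l * (x1 - (l^2 - x1 - x2)) - y1)"
proof (cases "x1 = x2")
  case True
  have "y1^2 = y2^2" using assms(1,2) True by (simp add: on_Pt)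
  then have "y1 = y2" using assms(3) True by (auto simp: power2_eq_iff)
  have "2 * y1 \<noteq> 0"
    using assms(3) True \<open>y1 = y2\<close> two_nonzero by auto
  define l where "l = (3 * x1^2 + a) / (2 * y1)"
  have "l * (2 * y1) = 3 * x1^2 + a" using \<open>2 * y1 \<noteq> 0\<close> by (simp add: l_def)
  then have "is_slope a l x1 y1 x2 y2"
    unfolding is_slope_def using True \<open>y1 = y2\<close> by algebra
  moreover have "Pt x1 y1 \<boxplus> Pt x2 y2 = Pt (l^2 - x1 - x2) (l * (x1 - (l^2 - x1 - x2)) - y1)"
    using assms(3) True by (simp add: Let_def l_def)
  ultimately show ?thesis by (rule that)
next
  case False
  define l where "l = (y2 - y1) / (x2 - x1)"
  have l: "l * (x2 - x1) = y2 - y1" using False by (simp add: l_def)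
  have "(x1 - x2) * (l * (y1 + y2)) = (x1 - x2) * (x1^2 + x1 * x2 + x2^2 + a)"
    using l assms(1,2) unfolding on_Pt by algebra
  then have "l * (y1 + y2) = x1^2 + x1 * x2 + x2^2 + a" using False by simp
  moreover have "l * (x1 - x2) = y1 - y2" using l by algebra
  ultimately have "is_slope a l x1 y1 x2 y2" by (simp add: is_slope_def)
  moreover have "Pt x1 y1 \<boxplus> Pt x2 y2 = Pt (l^2 - x1 - x2) (l * (x1 - (l^2 - x1 - x2)) - y1)"
    using False by (simp add: Let_def l_def)
  ultimately show ?thesis by (rule that)
qed

lemma add_eq:
  assumes "on (Pt x1 y1)" "on (Pt x2 y2)" "\<not> (x1 = x2 \<and> y1 = - y2)" "is_slope a l x1 y1 x2 y2"
    "x3 = l^2 - x1 - x2" "y3 = l * (x1 - x3) - y1"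
  shows "Pt x1 y1 \<boxplus> Pt x2 y2 = Pt x3 y3"
  using add_slopeE[OF assms(1-3)] slope_unique[OF _ assms(4,3)] assms(5,6) by metis

text \<open>Substituting the line gives a monic cubic in \<open>X\<close> with quadratic coefficient
  \<open>- l^2\<close>; its roots sum to \<open>l^2\<close>, which fixes the third one.\<close>

lemma line_cubic:
  assumes "on (Pt x1 y1)" "is_slope a l x1 y1 x2 y2"
  shows "X^3 + a * X + b - (y1 + l * (X - x1))^2 = (X - x1) * (X - x2) * (X - (l^2 - x1 - x2))"
  using assms unfolding on_Pt is_slope_def by algebra

lemma on_third:
  assumes "on (Pt x1 y1)" "is_slope a l x1 y1 x2 y2" "x3 = l^2 - x1 - x2" "y3 = l * (x1 - x3) - y1"
  shows "on (Pt x3 y3)"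
proof -
  have "x3^3 + a * x3 + b = (y1 + l * (x3 - x1))^2"
    using line_cubic[OF assms(1,2), of x3] assms(3) by simp
  also have "\<dots> = y3^2" unfolding assms(4) by algebra
  finally show ?thesis by (simp add: on_Pt)
qed

lemma on_add [simp]:
  assumes "on A" "on B"
  shows "on (A \<boxplus> B)"
proof (cases "A = Infty \<or> B = Infty \<or> B = ec_neg A")
  case True
  then show ?thesis using assms by auto
next
  case False
  then obtain x1 y1 x2 y2 where AB: "A = Pt x1 y1" "B = Pt x2 y2" by (metis ecpt.exhaust)
  with False have "\<not> (x1 = x2 \<and> y1 = - y2)" by auto
  then obtain l where l: "is_slope a l x1 y1 x2 y2"
    "A \<boxplus> B = Pt (l^2 - x1 - x2) (l * (x1 - (l^2 - x1 - x2)) - y1)"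
    using add_slopeE assms unfolding AB by metis
  show ?thesis
    unfolding l(2) by (rule on_third[OF _ l(1)]) (use assms AB in auto)
qed

lemma add_commute:
  assumes "on A" "on B"
  shows "A \<boxplus> B = B \<boxplus> A"
proof (cases "A = Infty \<or> B = Infty \<or> B = ec_neg A")
  case True
  then show ?thesis by auto
next
  case False
  then obtain x1 y1 x2 y2 where AB: "A = Pt x1 y1" "B = Pt x2 y2" by (metis ecpt.exhaust)
  with False have ne: "\<not> (x1 = x2 \<and> y1 = - y2)" by auto
  then obtain l where l: "is_slope a l x1 y1 x2 y2"
    "A \<boxplus> B = Pt (l^2 - x1 - x2) (l * (x1 - (l^2 - x1 - x2)) - y1)"
    using add_slopeE assms unfolding AB by metis
  have l': "is_slope a l x2 y2 x1 y1" using l(1) unfolding is_slope_def by algebra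
  have "B \<boxplus> A = Pt (l^2 - x1 - x2) (l * (x1 - (l^2 - x1 - x2)) - y1)"
    unfolding AB
  proof (rule add_eq[OF _ _ _ l'])
    show "l * (x1 - (l\<^sup>2 - x1 - x2)) - y1 = l * (x2 - (l\<^sup>2 - x1 - x2)) - y2"
      using l(1) unfolding is_slope_def by algebra
  qed (use assms AB ne in auto)
  then show ?thesis using l(2) by simp
qed

lemma neg_add:
  assumes "on A" "on B"
  shows "ec_neg (A \<boxplus> B) = ec_neg A \<boxplus> ec_neg B"
proof (cases "A = Infty \<or> B = Infty \<or> B = ec_neg A")
  case True
  then show ?thesis by auto
next
  case False
  then obtain x1 y1 x2 y2 where AB: "A = Pt x1 y1" "B = Pt x2 y2" by (metis ecpt.exhaust)
  with False have ne: "\<not> (x1 = x2 \<and> y1 = - y2)" by auto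
  then obtain l where l: "is_slope a l x1 y1 x2 y2"
    "A \<boxplus> B = Pt (l^2 - x1 - x2) (l * (x1 - (l^2 - x1 - x2)) - y1)"
    using add_slopeE assms unfolding AB by metis
  have l': "is_slope a (- l) x1 (- y1) x2 (- y2)" using l(1) unfolding is_slope_def by algebra
  have "Pt x1 (- y1) \<boxplus> Pt x2 (- y2) = Pt (l^2 - x1 - x2) (- (l * (x1 - (l^2 - x1 - x2)) - y1))"
    by (rule add_eq[OF _ _ _ l'])
       (use assms AB ne minus_equation_iff[of y1 y2] in \<open>auto simp: on_Pt algebra_simps\<close>)
  then show ?thesis using l(2) AB by simp
qed

text \<open>The line through \<open>A\<close> and \<open>C\<close>, reflected, passes through \<open>-A\<close> and \<open>A + C\<close>.\<close>
lemma add_cancel_left: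
  assumes "on A" "on C"
  shows "ec_neg A \<boxplus> (A \<boxplus> C) = C"
proof (cases "A = Infty \<or> C = Infty \<or> C = ec_neg A")
  case True
  then show ?thesis by auto
next
  case False
  then obtain x1 y1 x2 y2 where AC: "A = Pt x1 y1" "C = Pt x2 y2" by (metis ecpt.exhaust)
  with False have ne: "\<not> (x1 = x2 \<and> y1 = - y2)" by auto
  then obtain l where l: "is_slope a l x1 y1 x2 y2"
    "A \<boxplus> C = Pt (l^2 - x1 - x2) (l * (x1 - (l^2 - x1 - x2)) - y1)"
    using add_slopeE assms unfolding AC by metis
  define x3 y3 where "x3 = l^2 - x1 - x2" and "y3 = l * (x1 - x3) - y1"
  have D: "A \<boxplus> C = Pt x3 y3" using l(2) by (simp add: x3_def y3_def)
  have onD: "on (Pt x3 y3)" using on_add[OF assms] D by simp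
  have on1: "y1^2 = x1^3 + a * x1 + b" using assms AC by (simp add: on_Pt)
  have sl: "l * (x1 - x2) = y1 - y2" "l * (y1 + y2) = x1^2 + x1 * x2 + x2^2 + a"
    using l(1) by (auto simp: is_slope_def)
  have l': "is_slope a (- l) x1 (- y1) x3 y3"
    unfolding is_slope_def
  proof
    show "- l * (x1 - x3) = - y1 - y3" by (simp add: y3_def)
    show "- l * (- y1 + y3) = x1^2 + x1 * x3 + x3^2 + a"
      using sl unfolding y3_def x3_def by algebra
  qed
  \<comment> \<open>If the third point were again (x1, y1), then \<open>y1 = 0\<close> and
    \<open>x1\<close> would be a double root of the cubic, contradicting nonsingularity.\<close>
  have ne': "\<not> (x1 = x3 \<and> - y1 = - y3)"
  proof
    assume "x1 = x3 \<and> - y1 = - y3"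
    then have e: "x3 = x1" "y3 = y1" by auto
    have "y1 + y3 = l * (x1 - x3)" by (simp add: y3_def)
    then have "2 * y1 = 0" unfolding e mult_2 by simp
    then have "y1 = 0" using two_nonzero by simp
    moreover have "- l * (- y1 + y3) = x1^2 + x1 * x3 + x3^2 + a"
      using l' by (simp add: is_slope_def)
    ultimately have "3 * x1^2 + a = 0" "x1^3 + a * x1 + b = 0"
      using e on1 by (auto simp: algebra_simps power2_eq_square)
    then have "4 * a^3 + 27 * b^2 = 0" by algebra
    then show False using nonsingular by (simp add: nonsingular_def)
  qed
  have "Pt x1 (- y1) \<boxplus> Pt x3 y3 = Pt x2 y2"
  proof (rule add_eq[OF _ onD ne' l'])
    show "on (Pt x1 (- y1))" using on1 by (simp add: on_Pt)
    show "x2 = (- l)^2 - x1 - x3" by (simp add: x3_def)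
    show "y2 = - l * (x1 - x2) - - y1" using sl by algebra
  qed
  then show ?thesis using D AC by simp
qed

text \<open>After multiplication by \<open>x4 - x3\<close> this is a polynomial identity. If that
  factor is 0, then (A + B) + C is a doubling, and \<open>2 * y3\<close> serves as the factor
  instead.\<close>

lemma slope_sum:
  assumes "on (Pt x1 y1)" "on (Pt x3 y3)"
    and l: "is_slope a l x1 y1 x2 y2" and m: "is_slope a m x2 y2 x3 y3"
    and p: "is_slope a p x4 y4 x3 y3"
    and x4: "x4 = l^2 - x1 - x2" and y4: "y4 = l * (x1 - x4) - y1"
    and ne: "\<not> (x4 = x3 \<and> y4 = - y3)"
  shows "(l - m) * (l + p) = x1 - x3"
proof (cases "x4 = x3")
  case False
  have "(x4 - x3) * ((l - m) * (l + p)) = (x4 - x3) * (x1 - x3)"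
    using l m p x4 y4 unfolding is_slope_def by algebra
  then show ?thesis using False by simp
next
  case True
  have "on (Pt x4 y4)"
    by (rule on_third[OF assms(1) l x4 y4])
  then have "y4^2 = y3^2" using assms(2) True by (simp add: on_Pt)
  then have "y4 = y3" using ne True by (auto simp: power2_eq_iff)
  then have y3: "2 * y3 \<noteq> 0" using ne True two_nonzero by auto
  have "(2 * y3) * ((l - m) * (l + p)) = (2 * y3) * (x1 - x3)"
    using l m p x4 y4 True \<open>y4 = y3\<close> unfolding is_slope_def by algebra
  then show ?thesis using y3 by simp
qed

text \<open>With \<open>l\<close>, \<open>m\<close>, \<open>p\<close>, \<open>q\<close> the slopes for \<open>A + B\<close>, \<open>B + C\<close>, \<open>(A + B) + C\<close>, \<open>A + (B + C)\<close>,
  both \<open>l + p\<close> and \<open>m + q\<close> equal \<open>(x1 - x3) / (l - m)\<close>. If \<open>l = m\<close>, the three points are on one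
  line, and then \<open>A = C\<close> unless \<open>A + B + C = 0\<close>.\<close>
lemma add_assoc:
  assumes "on A" "on B" "on C"
  shows "(A \<boxplus> B) \<boxplus> C = A \<boxplus> (B \<boxplus> C)"
proof -
  have degenerate: "A' \<boxplus> (B' \<boxplus> C') = Infty" if "on A'" "on B'" "C' = ec_neg (A' \<boxplus> B')" for A' B' C'
  proof -
    have "C' = ec_neg B' \<boxplus> ec_neg A'" using that neg_add add_commute on_neg by metis
    then have "B' \<boxplus> C' = ec_neg A'" using add_cancel_left[of "ec_neg B'" "ec_neg A'"] that by simp
    then show ?thesis by simp
  qed
  \<comment> \<open>Cases 1 to 5 are those in which one of the four sums involves O or two opposite
    points; case 6 follows from commutativity.\<close>
  consider "A = Infty \<or> B = Infty \<or> C = Infty" | "B = ec_neg A" | "C = ec_neg B"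
    | "C = ec_neg (A \<boxplus> B)" | "A = ec_neg (B \<boxplus> C)" | "A = C"
    | "A \<noteq> Infty" "B \<noteq> Infty" "C \<noteq> Infty" "B \<noteq> ec_neg A" "C \<noteq> ec_neg B"
      "C \<noteq> ec_neg (A \<boxplus> B)" "A \<noteq> ec_neg (B \<boxplus> C)" "A \<noteq> C"
    by blast
  then show ?thesis
  proof cases
    case 1
    then show ?thesis by auto
  next
    case 2
    then show ?thesis using add_cancel_left[of "ec_neg A" C] assms by simp
  next
    case 3
    then show ?thesis using add_cancel_left[of B A] assms add_commute[of A B] add_commute[of "B \<boxplus> A" C]
      by simp
  next
    case 4
    then show ?thesis using degenerate[OF assms(1,2) 4] by simp
  next
    case 5
    have "C \<boxplus> (B \<boxplus> A) = Infty"
      using degenerate[of C B A] 5 assms add_commute by metis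
    then show ?thesis using 5 assms add_commute[of A B] add_commute[of "B \<boxplus> A" C]
        add_commute[of A "B \<boxplus> C"] by simp
  next
    case 6
    then show ?thesis using assms add_commute on_add by metis
  next
    case 7
    obtain x1 y1 x2 y2 x3 y3 where P: "A = Pt x1 y1" "B = Pt x2 y2" "C = Pt x3 y3"
      using 7 by (metis ecpt.exhaust)
    note on = assms[unfolded P]
    have n1: "\<not> (x1 = x2 \<and> y1 = - y2)" and n2: "\<not> (x2 = x3 \<and> y2 = - y3)"
      using 7(4,5) P by auto
    obtain l where l: "is_slope a l x1 y1 x2 y2"
      "A \<boxplus> B = Pt (l^2 - x1 - x2) (l * (x1 - (l^2 - x1 - x2)) - y1)"
      using add_slopeE on n1 unfolding P by metis
    obtain m where m: "is_slope a m x2 y2 x3 y3"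
      "B \<boxplus> C = Pt (m^2 - x2 - x3) (m * (x2 - (m^2 - x2 - x3)) - y2)"
      using add_slopeE on n2 unfolding P by metis
    define x4 y4 where x4: "x4 = l^2 - x1 - x2" and y4: "y4 = l * (x1 - x4) - y1"
    \<comment> \<open>Written from C + B, so that \<open>slope_sum\<close> applies a second time
      with A and C exchanged.\<close>
    define x5 y5 where x5: "x5 = m^2 - x3 - x2" and y5: "y5 = m * (x3 - x5) - y3"
    have D: "A \<boxplus> B = Pt x4 y4" using l(2) by (simp add: x4 y4)
    have E: "B \<boxplus> C = Pt x5 y5"
    proof -
      have "m * (x2 - (m^2 - x2 - x3)) - y2 = y5"
        using m(1) unfolding x5 y5 is_slope_def by algebra
      then show ?thesis using m(2) by (simp add: x5 algebra_simps)
    qed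
    have onD: "on (Pt x4 y4)" and onE: "on (Pt x5 y5)"
      using on_add[of A B] on_add[of B C] D E assms by auto
    have n3: "\<not> (x4 = x3 \<and> y4 = - y3)" and n4: "\<not> (x5 = x1 \<and> y5 = - y1)"
      using 7(6,7) D E P by auto
    obtain p where p: "is_slope a p x4 y4 x3 y3"
      "(A \<boxplus> B) \<boxplus> C = Pt (p^2 - x4 - x3) (p * (x4 - (p^2 - x4 - x3)) - y4)"
      using add_slopeE onD on(3) n3 unfolding D P(3) by metis
    obtain q where q: "is_slope a q x5 y5 x1 y1"
      "(B \<boxplus> C) \<boxplus> A = Pt (q^2 - x5 - x1) (q * (x5 - (q^2 - x5 - x1)) - y5)"
      using add_slopeE onE on(1) n4 unfolding E P(1) by metis
    have m': "is_slope a m x3 y3 x2 y2" and l': "is_slope a l x2 y2 x1 y1"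
      using m(1) l(1) by (auto simp: is_slope_def algebra_simps)
    have s1: "(l - m) * (l + p) = x1 - x3"
      by (rule slope_sum[OF on(1,3) l(1) m(1) p(1) x4 y4 n3])
    have s2: "(m - l) * (m + q) = x3 - x1"
      by (rule slope_sum[OF on(3,1) m' l' q(1) x5 y5 n4])
    have "l \<noteq> m"
    proof
      assume "l = m"
      then have "x1 = x3" using s1 by simp
      moreover have "y1 = y3"
        using l(1) m(1) \<open>l = m\<close> \<open>x1 = x3\<close> unfolding is_slope_def by algebra
      ultimately show False using 7(8) P by simp
    qed
    have "(l - m) * (l + p) = (l - m) * (m + q)" using s1 s2 by algebra
    then have pq: "l + p = m + q" using \<open>l \<noteq> m\<close> by simp
    have "p^2 - x4 - x3 = q^2 - x5 - x1"
      using pq s1 s2 unfolding x4 x5 by algebra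
    moreover have "p * (x4 - (p^2 - x4 - x3)) - y4 = q * (x5 - (q^2 - x5 - x1)) - y5"
      using pq s1 s2 l(1) m(1) p(1) q(1) unfolding x4 x5 y4 y5 is_slope_def by algebra
    ultimately have "(A \<boxplus> B) \<boxplus> C = (B \<boxplus> C) \<boxplus> A" using p(2) q(2) by simp
    then show ?thesis using add_commute assms on_add by metis
  qed
qed

lemma comm_group_ec_group: "comm_group (ec_group a b)"
proof (rule comm_groupI)
  fix A assume "A \<in> carrier (ec_group a b)"
  then show "\<exists>B\<in>carrier (ec_group a b). B \<otimes>\<^bsub>ec_group a b\<^esub> A = \<one>\<^bsub>ec_group a b\<^esub>"
    by (intro bexI[of _ "ec_neg A"]) (auto simp: ec_group_def ec_points_def)
next
  fix A B assume "A \<in> carrier (ec_group a b)" "B \<in> carrier (ec_group a b)"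
  then show "A \<otimes>\<^bsub>ec_group a b\<^esub> B = B \<otimes>\<^bsub>ec_group a b\<^esub> A"
    by (simp add: ec_group_def ec_points_def add_commute)
qed (auto simp: ec_group_def ec_points_def add_assoc)

end

section \<open>Specialization\<close>

text \<open>The denominator in lowest terms divides \<open>q\<close>, so it does not vanish at
  \<open>t0\<close> either, and the common factor cancels from the value.\<close>

lemma regular_Fract:
  assumes "poly q t0 \<noteq> 0"
  shows "\<not> has_pole (Fract p q) t0" "rf_eval (Fract p q) t0 = poly p t0 / poly q t0"
proof -
  have "q \<noteq> 0" using assms by auto
  obtain d where d: "p = fst (normalize_quot (p, q)) * d" "q = snd (normalize_quot (p, q)) * d"
    using normalize_quotE[OF \<open>q \<noteq> 0\<close>, of p] by metis
  have qf: "quot_of_fract (Fract p q) = normalize_quot (p, q)"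
    using quot_of_fract_quot_to_fract[of "(p, q)"] by (simp add: quot_to_fract_def)
  have pq: "poly p t0 = poly (fst (normalize_quot (p, q))) t0 * poly d t0"
    "poly q t0 = poly (snd (normalize_quot (p, q))) t0 * poly d t0"
    using d by (metis poly_mult)+
  then show "\<not> has_pole (Fract p q) t0" using assms by (auto simp: has_pole_def qf)
  show "rf_eval (Fract p q) t0 = poly p t0 / poly q t0"
    using assms unfolding pq by (simp add: rf_eval_def qf case_prod_unfold)
qed

lemma regularE:
  assumes "\<not> has_pole f t0"
  obtains p q where "f = Fract p q" "poly q t0 \<noteq> 0" "rf_eval f t0 = poly p t0 / poly q t0"
  using assms that[of "fst (quot_of_fract f)" "snd (quot_of_fract f)"]
  by (auto simp: has_pole_def rf_eval_def case_prod_unfold)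

lemma regular_add:
  assumes "\<not> has_pole f t0" "\<not> has_pole g t0"
  shows "\<not> has_pole (f + g) t0" "rf_eval (f + g) t0 = rf_eval f t0 + rf_eval g t0"
proof -
  obtain p q where f: "f = Fract p q" "poly q t0 \<noteq> 0" "rf_eval f t0 = poly p t0 / poly q t0"
    by (rule regularE[OF assms(1)])
  obtain r s where g: "g = Fract r s" "poly s t0 \<noteq> 0" "rf_eval g t0 = poly r t0 / poly s t0"
    by (rule regularE[OF assms(2)])
  have "q \<noteq> 0" "s \<noteq> 0" using f g by auto
  then have fg: "f + g = Fract (p * s + r * q) (q * s)" using f g by simp
  have "poly (q * s) t0 \<noteq> 0" using f g by simp
  from regular_Fract[OF this] show "\<not> has_pole (f + g) t0"
    "rf_eval (f + g) t0 = rf_eval f t0 + rf_eval g t0"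
    using f(2,3) g(2,3) by (simp_all add: fg add_frac_eq)
qed

lemma regular_mult:
  assumes "\<not> has_pole f t0" "\<not> has_pole g t0"
  shows "\<not> has_pole (f * g) t0" "rf_eval (f * g) t0 = rf_eval f t0 * rf_eval g t0"
proof -
  obtain p q where f: "f = Fract p q" "poly q t0 \<noteq> 0" "rf_eval f t0 = poly p t0 / poly q t0"
    by (rule regularE[OF assms(1)])
  obtain r s where g: "g = Fract r s" "poly s t0 \<noteq> 0" "rf_eval g t0 = poly r t0 / poly s t0"
    by (rule regularE[OF assms(2)])
  have "poly (q * s) t0 \<noteq> 0" using f g by simp
  from regular_Fract[OF this, of "p * r"] show "\<not> has_pole (f * g) t0"
    "rf_eval (f * g) t0 = rf_eval f t0 * rf_eval g t0"
    using f g by simp_all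
qed

lemma regular_rf: "\<not> has_pole (rf p) t0" "rf_eval (rf p) t0 = poly p t0"
  using regular_Fract[of 1 t0 p] by (simp_all add: rf_def to_fract_def)

lemma regular_numeral [simp]:
  "\<not> has_pole 0 t0" "rf_eval 0 t0 = 0" "\<not> has_pole 1 t0" "rf_eval 1 t0 = 1"
  "\<not> has_pole (numeral n) t0" "rf_eval (numeral n) t0 = numeral n"
proof -
  have num: "numeral n = rf (numeral n)" for n
  proof -
    have "of_nat k = rf (of_nat k)" for k
      by (induction k) (simp_all add: rf_def)
    then show ?thesis by (metis of_nat_numeral)
  qed
  show "\<not> has_pole (numeral n) t0" "rf_eval (numeral n) t0 = numeral n"
    unfolding num using regular_rf[of "numeral n" t0] by simp_all
qed (use regular_rf[of 0 t0] regular_rf[of 1 t0] in \<open>simp_all add: rf_def\<close>)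

lemma regular_uminus:
  assumes "\<not> has_pole f t0"
  shows "\<not> has_pole (- f) t0" "rf_eval (- f) t0 = - rf_eval f t0"
proof -
  have "\<not> has_pole (rf (- 1)) t0" "rf_eval (rf (- 1)) t0 = - 1" using regular_rf[of "- 1" t0] by simp_all
  moreover have "- f = rf (- 1) * f" by (simp add: rf_def)
  ultimately show "\<not> has_pole (- f) t0" "rf_eval (- f) t0 = - rf_eval f t0"
    using regular_mult[of "rf (- 1)" t0 f] assms by simp_all
qed

lemma regular_diff:
  assumes "\<not> has_pole f t0" "\<not> has_pole g t0"
  shows "\<not> has_pole (f - g) t0" "rf_eval (f - g) t0 = rf_eval f t0 - rf_eval g t0"
  using regular_add[of f t0 "- g"] regular_uminus[of g t0] assms by simp_all

lemma regular_power:
  assumes "\<not> has_pole f t0"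
  shows "\<not> has_pole (f ^ n) t0 \<and> rf_eval (f ^ n) t0 = rf_eval f t0 ^ n"
  by (induction n) (use assms in \<open>auto simp: regular_mult\<close>)

lemmas regular_simps = regular_add regular_mult regular_diff regular_uminus regular_power regular_rf

lemma regular_inverse:
  assumes "\<not> has_pole f t0" "rf_eval f t0 \<noteq> 0"
  shows "\<not> has_pole (inverse f) t0"
proof -
  obtain p q where f: "f = Fract p q" "poly q t0 \<noteq> 0" "rf_eval f t0 = poly p t0 / poly q t0"
    by (rule regularE[OF assms(1)])
  have "poly p t0 \<noteq> 0" using assms(2) f by auto
  then show ?thesis using regular_Fract[of p t0 q] f(1) by simp
qed

text \<open>Numerator and denominator in lowest terms have no common root, so at a pole the
  numerator is nonzero and may serve as denominator of the inverse.\<close>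

lemma pole_inverse:
  assumes "has_pole f t0"
  shows "\<not> has_pole (inverse f) t0" "rf_eval (inverse f) t0 = 0"
proof -
  define p q where "p = fst (quot_of_fract f)" and "q = snd (quot_of_fract f)"
  have f: "f = Fract p q" by (simp add: p_def q_def)
  have q: "poly q t0 = 0" using assms by (simp add: has_pole_def q_def)
  have "coprime p q" unfolding p_def q_def by (rule coprime_quot_of_fract)
  have p: "poly p t0 \<noteq> 0"
  proof
    assume "poly p t0 = 0"
    then have "[:- t0, 1:] dvd p" "[:- t0, 1:] dvd q" using q by (simp_all add: poly_eq_0_iff_dvd)
    then have "is_unit [:- t0, 1:]" using \<open>coprime p q\<close> by (meson coprime_common_divisor)
    then show False by (simp add: is_unit_iff_degree)
  qed
  show "\<not> has_pole (inverse f) t0" "rf_eval (inverse f) t0 = 0"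
    using regular_Fract[OF p, of q] q unfolding f by simp_all
qed

lemma pole_nonzero: "has_pole f t0 \<Longrightarrow> f \<noteq> 0"
  by auto

text \<open>At a pole of \<open>f\<close> the product of \<open>f^2\<close> and
  \<open>inverse f^2\<close>, which is 1, would have the value 0. The lemma turns regularity of
  \<open>y^2\<close> into that of \<open>y\<close>.\<close>

lemma regular_of_square:
  assumes "\<not> has_pole (f^2) t0"
  shows "\<not> has_pole f t0"
proof
  assume f: "has_pole f t0"
  have "f^2 * inverse f^2 = 1" using pole_nonzero[OF f] by (simp flip: power_mult_distrib)
  moreover have "rf_eval (f^2 * inverse f^2) t0 = 0"
    using assms pole_inverse[OF f] by (simp add: regular_simps)
  ultimately show False by simp
qed

section \<open>The specialization map on points and its additivity\<close>

locale specialization =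
  fixes t0 :: rat and a b :: ratfun
  assumes regular_a: "\<not> has_pole a t0" and regular_b: "\<not> has_pole b t0"
    and nonsingular_fibre: "nonsingular (rf_eval a t0) (rf_eval b t0)"
    and no_two_torsion: "x^3 + rf_eval a t0 * x + rf_eval b t0 \<noteq> 0"
begin

abbreviation ev :: "ratfun \<Rightarrow> rat" where "ev f \<equiv> rf_eval f t0"
abbreviation reg :: "ratfun \<Rightarrow> bool" where "reg f \<equiv> \<not> has_pole f t0"

sublocale K: elliptic_curve "ev a" "ev b"
  by unfold_locales (use nonsingular_fibre in auto)

sublocale F: elliptic_curve a b
proof
  \<comment> \<open>The discriminant specializes to that of the fibre, so it is not identically
    zero.\<close>
  have "ev (4 * a^3 + 27 * b^2) = 4 * ev a^3 + 27 * ev b^2"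
    using regular_a regular_b by (simp add: regular_simps)
  then show "nonsingular a b"
    using nonsingular_fibre unfolding nonsingular_def by (metis regular_numeral(2))
  have "ev 2 = 2" by (rule regular_numeral)
  then show "(2::ratfun) \<noteq> 0" by (metis regular_numeral(2) zero_neq_numeral)
qed

lemma regular_y:
  assumes "F.on (Pt x y)" "reg x"
  shows "reg y"
proof (rule regular_of_square)
  show "reg (y^2)" using assms regular_a regular_b by (simp add: F.on_Pt regular_simps)
qed

lemma spec_Infty [simp]: "spec t0 Infty = Infty"
  by (simp add: spec_def)

lemma spec_Pt:
  assumes "F.on (Pt x y)"
  shows "spec t0 (Pt x y) = (if reg x then Pt (ev x) (ev y) else Infty)"
  using regular_y[OF assms] by (simp add: spec_def)

lemma on_spec_Pt:
  assumes "F.on (Pt x y)" "reg x"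
  shows "K.on (Pt (ev x) (ev y))"
proof -
  have "ev (y^2) = ev (x^3 + a * x + b)" using assms(1) by (simp add: F.on_Pt)
  then show ?thesis
    using regular_a regular_b assms regular_y[OF assms] by (simp add: K.on_Pt regular_simps)
qed

lemma on_spec:
  assumes "F.on A"
  shows "K.on (spec t0 A)"
  using assms by (cases A) (auto simp: spec_Pt on_spec_Pt)

lemma spec_neg:
  assumes "F.on A"
  shows "spec t0 (ec_neg A) = ec_neg (spec t0 A)"
proof (cases A)
  case (Pt x y)
  then have "F.on (Pt x (- y))" using assms by (simp add: F.on_Pt)
  then show ?thesis using assms Pt regular_y[of x y] by (simp add: spec_Pt regular_simps)
qed simp

text \<open>No rational point of the fibre other than O is its own negative. This decides the case
  of opposite images in the addition of regular points.\<close>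

lemma y_nonzero:
  assumes "K.on (Pt x y)"
  shows "y \<noteq> 0"
  using assms no_two_torsion[of x] by (auto simp: K.on_Pt)

text \<open>If the images are opposite but the points are not, the slope has a pole, hence so does
  the abscissa of the sum, which goes to O. Otherwise one of the two equations in
  \<open>is_slope\<close> can be solved for the slope with a denominator that is nonzero at
  \<open>t0\<close>, and the addition formula specializes.\<close>

lemma spec_add_regular_regular:
  assumes "F.on (Pt x y)" "F.on (Pt u v)" "reg x" "reg u"
  shows "spec t0 (F.add (Pt x y) (Pt u v)) = K.add (spec t0 (Pt x y)) (spec t0 (Pt u v))"
proof (cases "x = u \<and> y = - v")
  case True
  have "reg v" by (rule regular_y[OF assms(2,4)])
  then show ?thesis using True assms by (simp add: spec_Pt regular_simps)
next
  case False
  define X Y where "X = Pt (ev x) (ev y)" and "Y = Pt (ev u) (ev v)"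
  have sp: "spec t0 (Pt x y) = X" "spec t0 (Pt u v) = Y"
    using assms by (simp_all add: X_def Y_def spec_Pt)
  have onK: "K.on (Pt (ev x) (ev y))" "K.on (Pt (ev u) (ev v))" using assms by (simp_all add: on_spec_Pt)
  have ry: "reg y" "reg v" using regular_y assms by blast+
  obtain l where l: "is_slope a l x y u v"
    "F.add (Pt x y) (Pt u v) = Pt (l^2 - x - u) (l * (x - (l^2 - x - u)) - y)"
    using F.add_slopeE[OF assms(1,2) False] by blast
  define x3 y3 where x3: "x3 = l^2 - x - u" and y3: "y3 = l * (x - x3) - y"
  have C: "F.add (Pt x y) (Pt u v) = Pt x3 y3" using l(2) by (simp add: x3 y3)
  have onC: "F.on (Pt x3 y3)" using F.on_add[OF assms(1,2)] C by simp
  have l1: "l * (x - u) = y - v" and l2: "l * (y + v) = x^2 + x * u + u^2 + a"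
    using l(1) by (auto simp: is_slope_def)
  show ?thesis
  proof (cases "ev x = ev u \<and> ev y = - ev v")
    case True
    have "has_pole l t0"
    proof (rule ccontr)
      assume "reg l"
      then have "ev (l * (x - u)) = 0" using True assms by (simp add: regular_simps)
      then have "ev y - ev v = 0" unfolding l1 using ry by (simp add: regular_simps)
      then have "ev v = 0" using True by simp
      then show False using y_nonzero onK by blast
    qed
    have "has_pole x3 t0"
    proof (rule ccontr)
      assume "reg x3"
      then have "reg (x3 + x + u)" using assms by (simp add: regular_simps)
      then have "reg (l^2)" by (simp add: x3)
      then show False using \<open>has_pole l t0\<close> regular_of_square by blast
    qed
    then show ?thesis using True C onC sp by (simp add: spec_Pt X_def Y_def)
  next
    case ne: False
    have "reg l"
    proof (cases "ev x = ev u")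
      case True
      then have "ev (y + v) \<noteq> 0" using ne ry by (simp add: regular_simps eq_neg_iff_add_eq_0)
      moreover from this have "y + v \<noteq> 0" by auto
      then have "l = (x^2 + x * u + u^2 + a) * inverse (y + v)"
        unfolding l2[symmetric] by (simp add: mult.assoc)
      ultimately show ?thesis
        using regular_inverse[of "y + v" t0] assms ry regular_a by (simp add: regular_simps)
    next
      case False
      then have "ev (x - u) \<noteq> 0" using assms by (simp add: regular_simps)
      moreover from this have "x - u \<noteq> 0" by auto
      then have "l = (y - v) * inverse (x - u)"
        unfolding l1[symmetric] by (simp add: mult.assoc)
      ultimately show ?thesis
        using regular_inverse[of "x - u" t0] assms ry by (simp add: regular_simps)
    qed
    have "ev (l * (x - u)) = ev (y - v)" "ev (l * (y + v)) = ev (x^2 + x * u + u^2 + a)"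
      using l1 l2 by simp_all
    then have "is_slope (ev a) (ev l) (ev x) (ev y) (ev u) (ev v)"
      using assms ry \<open>reg l\<close> regular_a by (simp add: is_slope_def regular_simps)
    moreover have "reg x3" "ev x3 = ev l^2 - ev x - ev u"
      using \<open>reg l\<close> assms by (simp_all add: x3 regular_simps)
    moreover have "ev y3 = ev l * (ev x - ev x3) - ev y"
      using \<open>reg l\<close> \<open>reg x3\<close> assms ry by (simp add: y3 regular_simps)
    ultimately show ?thesis
      using K.add_eq[OF onK ne] onC C sp by (simp add: spec_Pt X_def Y_def)
  qed
qed

text \<open>In terms of \<open>w = 1/x\<close> and \<open>z = y/x\<^sup>2\<close>, which are regular when \<open>x\<close> has a pole, the abscissa of the
  sum has a denominator that is 1 at \<open>t0\<close>.\<close>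
lemma regular_pole_add:
  assumes "F.on (Pt x y)" "F.on (Pt u v)" "has_pole x t0" "reg u"
  obtains x3 y3 where "F.add (Pt x y) (Pt u v) = Pt x3 y3" "reg x3"
proof -
  have ne: "x \<noteq> u" using assms by auto
  then obtain l where l: "is_slope a l x y u v"
    "F.add (Pt x y) (Pt u v) = Pt (l^2 - x - u) (l * (x - (l^2 - x - u)) - y)"
    using F.add_slopeE[OF assms(1,2)] by blast
  define x3 where "x3 = l^2 - x - u"
  define w z where "w = inverse x" and "z = y * w^2"
  have w: "reg w" "ev w = 0" using pole_inverse[OF assms(3)] by (simp_all add: w_def)
  have xw: "x * w = 1" using pole_nonzero[OF assms(3)] by (simp add: w_def)
  have y2: "y^2 = x^3 + a * x + b" and v2: "v^2 = u^3 + a * u + b"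
    using assms(1,2) by (simp_all add: F.on_Pt)
  have "z^2 = w + a * w^3 + b * w^4" using xw y2 unfolding z_def by algebra
  then have "reg (z^2)" using w regular_a regular_b by (simp add: regular_simps)
  then have "reg z" by (rule regular_of_square)
  have l1: "l * (x - u) = y - v" using l(1) by (simp add: is_slope_def)
  \<comment> \<open>In \<open>(y - v)^2 - (x + u) * (x - u)^2\<close> the terms \<open>x^3\<close>
    cancel by the curve equation; multiplying the rest by \<open>w^2\<close> leaves
    \<open>N\<close>, which is free of poles.\<close>
  define N where "N = u + w * (a + u^2) - 2 * (z * v) + w^2 * (b + v^2 - u^3)"
  have "x3 * (1 - u * w)^2 = N"
    using l1 xw y2 unfolding x3_def N_def z_def by algebra
  moreover have ev1: "reg ((1 - u * w)^2)" "ev ((1 - u * w)^2) = 1"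
    using w assms by (simp_all add: regular_simps)
  then have "(1 - u * w)^2 \<noteq> 0" by auto
  ultimately have "x3 = N * inverse ((1 - u * w)^2)" by (metis mult.assoc mult.right_neutral right_inverse)
  moreover have "reg N"
    using w assms regular_a regular_b \<open>reg z\<close> regular_y[OF assms(2,4)] unfolding N_def
    by (simp add: regular_simps)
  ultimately have "reg x3" using regular_inverse[OF ev1(1)] ev1(2) by (simp add: regular_simps)
  then show ?thesis using that l(2) by (simp add: x3_def)
qed

text \<open>If the first summand A has a pole, then C = A + B is regular. The regular case for C +
  (-B) = A gives O as the sum of the images of C and -B, so C and B have the same image.\<close>

lemma spec_add_regular:
  assumes "F.on A" "F.on (Pt u v)" "reg u"
  shows "spec t0 (F.add A (Pt u v)) = K.add (spec t0 A) (spec t0 (Pt u v))"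
proof (cases A)
  case Infty
  then show ?thesis by simp
next
  case (Pt x y)
  show ?thesis
  proof (cases "reg x")
    case True
    then show ?thesis using spec_add_regular_regular assms Pt by simp
  next
    case False
    obtain x3 y3 where C: "F.add (Pt x y) (Pt u v) = Pt x3 y3" "reg x3"
      using regular_pole_add[OF _ assms(2)] False assms Pt by blast
    have onC: "F.on (Pt x3 y3)" using F.on_add[of "Pt x y" "Pt u v"] assms Pt C by simp
    have onV: "F.on (Pt u (- v))" using F.on_neg[of "Pt u v"] assms(2) by simp
    have "F.add (Pt x3 y3) (Pt u (- v)) = Pt x y"
      using F.add_assoc[of "Pt x y" "Pt u v" "Pt u (- v)"] assms Pt onV C(1) by simp
    then have "Infty = K.add (spec t0 (Pt x3 y3)) (spec t0 (Pt u (- v)))"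
      using spec_add_regular_regular[OF onC onV C(2) assms(3)] False assms(1) Pt by (simp add: spec_Pt)
    then have "spec t0 (Pt u (- v)) = ec_neg (spec t0 (Pt x3 y3))"
      by (metis ec_add_eq_Infty_iff)
    moreover have "spec t0 (Pt u (- v)) = ec_neg (spec t0 (Pt u v))"
      using spec_neg[OF assms(2)] by simp
    ultimately have "spec t0 (Pt x3 y3) = spec t0 (Pt u v)" by (metis ec_neg_neg)
    then show ?thesis using C(1) Pt False assms(1) by (simp add: spec_Pt)
  qed
qed

text \<open>By commutativity one finite image suffices. If both images are O but that of A + B were
  finite, then A = -B + (A + B) would have a finite image too.\<close>

lemma spec_add:
  assumes "F.on A" "F.on B"
  shows "spec t0 (F.add A B) = K.add (spec t0 A) (spec t0 B)"
proof -
  have right: "spec t0 (F.add A' B') = K.add (spec t0 A') (spec t0 B')"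
    if "F.on A'" "F.on B'" "spec t0 B' \<noteq> Infty" for A' B'
    using that spec_add_regular by (cases B') (auto simp: spec_Pt split: if_splits)
  consider "spec t0 B \<noteq> Infty" | "spec t0 A \<noteq> Infty" | "spec t0 A = Infty" "spec t0 B = Infty"
    by blast
  then show ?thesis
  proof cases
    case 1
    then show ?thesis using right assms by blast
  next
    case 2
    then show ?thesis using right[of B A] assms F.add_commute K.add_commute on_spec by metis
  next
    case 3
    have "F.add (ec_neg B) (F.add B A) = A" by (rule F.add_cancel_left[OF assms(2,1)])
    then have "F.add (ec_neg B) (F.add A B) = A" using F.add_commute[OF assms] by simp
    then have "spec t0 (F.add A B) = Infty"
      using right[of "ec_neg B" "F.add A B"] assms 3 spec_neg[OF assms(2)] by fastforce
    then show ?thesis using 3 by simp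
  qed
qed

lemma spec_hom: "spec t0 \<in> hom (ec_group a b) (ec_group (ev a) (ev b))"
  by (auto simp: hom_def ec_group_def ec_points_def on_spec spec_add)

end

section \<open>Local conditions for 2-descent\<close>

lemma squarefree_dvdI:
  fixes d N :: "'a::factorial_semiring"
  assumes "squarefree d" "\<And>l. prime l \<Longrightarrow> l dvd d \<Longrightarrow> l dvd N"
  shows "d dvd N"
proof (cases "N = 0")
  case False
  have "d \<noteq> 0" using assms(1) by auto
  show ?thesis
  proof (rule multiplicity_le_imp_dvd[OF \<open>d \<noteq> 0\<close>])
    fix l :: 'a assume "prime l"
    show "multiplicity l d \<le> multiplicity l N"
    proof (cases "l dvd d")
      case True
      have "multiplicity l d \<le> 1"
        using squarefree_factorial_semiring''[OF \<open>d \<noteq> 0\<close>] assms(1) \<open>prime l\<close> by blast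
      also have "1 \<le> multiplicity l N"
        using assms(2)[OF \<open>prime l\<close> True] False \<open>prime l\<close>
        by (simp add: Suc_le_eq prime_multiplicity_gt_zero_iff)
      finally show ?thesis .
    qed (simp add: not_dvd_imp_multiplicity_0)
  qed
qed auto

lemma squarefree_dvd_square:
  fixes d w :: int
  assumes "squarefree d" "d dvd w^2"
  shows "d dvd w"
  by (rule squarefree_dvdI[OF assms(1)]) (use assms(2) in \<open>meson dvd_trans prime_dvd_power\<close>)

lemma square_cofactor:
  fixes y D T :: int
  assumes "T * D^2 = y^2" "D \<noteq> 0"
  obtains w where "T = w^2"
proof -
  have "D^2 dvd y^2" using assms(1) by (metis dvd_triv_right)
  then have "D dvd y" by simp
  then obtain w where "y = D * w" by (auto simp: dvd_def)
  then have "T * D^2 = w^2 * D^2" using assms(1) by (simp add: power_mult_distrib)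
  then show ?thesis using assms(2) that by simp
qed

lemma coprime_mult_square:
  fixes M T w :: int
  assumes "coprime M T" "M * T = w^2" "M > 0" and w: "w \<noteq> 0"
  obtains k where "M = k^2"
proof -
  have "nat M * nat \<bar>T\<bar> = nat \<bar>w\<bar> ^ 2"
    using assms(2,3) by (metis abs_mult abs_of_pos nat_abs_mult_distrib nat_power_eq abs_ge_zero power_abs)
  moreover have "coprime (nat M) (nat \<bar>T\<bar>)"
    using assms(1,3) by (simp flip: coprime_int_iff)
  ultimately have "is_nth_power 2 (nat M * nat \<bar>T\<bar>)" "coprime (nat M) (nat \<bar>T\<bar>)"
    by simp_all
  then have "is_nth_power 2 (nat M)"
    using is_nth_power_mult_coprime_natD(1)[of "nat M" "nat \<bar>T\<bar>" 2] assms(2,3) w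
    by (cases "T = 0") simp_all
  then obtain m where "nat M = m^2" by (auto elim: is_nth_powerE)
  then have "M = (int m)^2" using assms(3) by (metis int_nat_eq of_nat_power order_less_imp_le)
  then show ?thesis by (rule that)
qed

lemma int_square_of_rat:
  assumes "(of_int T :: rat) = r^2"
  obtains w where "T = w^2"
proof -
  obtain u v where uv: "quotient_of r = (u, v)" by force
  have v: "v > 0" and r: "r = of_int u / of_int v"
    using quotient_of_denom_pos[OF uv] quotient_of_div[OF uv] by auto
  have "of_int (T * v^2) = (of_int (u^2) :: rat)" using assms v by (simp add: r field_simps)
  then have "T * v^2 = u^2" by (simp only: of_int_eq_iff)
  then show ?thesis using square_cofactor[of T v u] v that by auto
qed

text \<open>For a prime \<open>r\<close>: \<open>s\<close> is a square modulo \<open>r\<close>, zero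
  included. The factor \<open>h\<close> replaces a modular inverse, and the bounded search makes the
  condition executable.\<close>

definition quad_res :: "int \<Rightarrow> int \<Rightarrow> bool" where
  "quad_res r s \<longleftrightarrow> (\<exists>h\<in>set [1..r - 1]. \<exists>w\<in>set [0..r - 1]. (s * h^2 - w^2) mod r = 0)"

lemma quad_resI:
  assumes "r > 0" "\<not> r dvd h" "r dvd s * h^2 - w^2"
  shows "quad_res r s"
proof -
  have "h mod r \<noteq> 0" using assms(2) by (simp add: dvd_eq_mod_eq_0)
  then have "h mod r \<in> set [1..r - 1]" "w mod r \<in> set [0..r - 1]"
    using pos_mod_bound[OF assms(1), of h] pos_mod_bound[OF assms(1), of w]
      pos_mod_sign[OF assms(1), of h] pos_mod_sign[OF assms(1), of w]
    unfolding set_upto atLeastAtMost_iff by linarith+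
  moreover have "(s * (h mod r)^2 - (w mod r)^2) mod r = (s * h^2 - w^2) mod r"
    by (intro mod_diff_cong mod_mult_cong) (simp_all add: power_mod)
  ultimately show ?thesis using assms(3) unfolding quad_res_def by fastforce
qed

lemma prime_dvd_not_coprime:
  fixes r m n :: int
  assumes "prime r" "r dvd m" "r dvd n"
  shows "\<not> coprime m n"
  using assms by (meson coprime_common_divisor not_prime_unit)

text \<open>Modulo \<open>r\<close> the integers U and V agree. If they are units, then U V is a
  square and W must be one up to \<open>r\<close>, so its class \<open>dW\<close> is a square. If
  both vanish, W is congruent to \<open>e * k^2\<close> with \<open>k\<close> a unit, so
  \<open>dW * e\<close> is a square.\<close>

lemma local_condition_weak:
  fixes U V W :: int
  assumes r: "prime r" and y: "U * V * W = y^2"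
    and W: "W = dW * C^2" "C \<noteq> 0"
    and \<delta>: "V - U = \<delta> * k^2" "r dvd \<delta>" and e: "W - U = e * k^2" "\<not> r dvd e"
    and k: "coprime U k"
  shows "(\<not> r dvd U \<and> \<not> r dvd V \<and> quad_res r dW) \<or> (r dvd U \<and> r dvd V \<and> \<not> r dvd dW \<and> quad_res r (dW * e))"
proof (cases "r dvd U")
  case True
  have "r dvd V" using True \<delta> by (metis dvd_add_right_iff dvd_mult2 diff_add_cancel)
  have "\<not> r dvd W"
  proof
    assume "r dvd W"
    then have "r dvd e * k^2" using e(1) True by (metis dvd_diff)
    then show False using e(2) True k r prime_dvd_not_coprime[of r U k] by (simp add: prime_dvd_mult_iff prime_dvd_power_iff)
  qed
  then have "\<not> r dvd C" and dW: "\<not> r dvd dW" using W(1) by (auto simp: power2_eq_square)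
  moreover have "dW * e * C^2 - (e * k)^2 = e * U"
    using W(1) e(1) by algebra
  ultimately have "quad_res r (dW * e)"
    using True prime_gt_0_int[OF r] by (intro quad_resI[of r C _ "e * k"]) auto
  then show ?thesis using True \<open>r dvd V\<close> dW by blast
next
  case False
  have "\<not> r dvd V" using False \<delta> by (metis dvd_diff dvd_mult2 diff_diff_eq2 add_diff_cancel_left')
  have "(U * V * dW) * C^2 = y^2" using y W(1) by simp
  then obtain w where "U * V * dW = w^2" using square_cofactor W(2) by blast
  then have "dW * U^2 - w^2 = dW * U * (U - V)" by algebra
  also have "r dvd \<dots>" using \<delta> by (metis dvd_mult dvd_mult2 dvd_minus_iff minus_diff_eq)
  finally have "quad_res r dW" using False prime_gt_0_int[OF r] by (intro quad_resI[of r U _ w]) auto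
  then show ?thesis using False \<open>\<not> r dvd V\<close> by blast
qed

text \<open>A condition at the prime \<open>r\<close> on the square classes of three integers \<open>U\<close>, \<open>V\<close>, \<open>W\<close> with square
  product, where \<open>r\<close> divides \<open>V - U\<close> exactly once and \<open>W - U = e k\<^sup>2\<close>.\<close>
definition admissible_at :: "int \<Rightarrow> int \<Rightarrow> int \<Rightarrow> int \<Rightarrow> int \<Rightarrow> bool" where
  "admissible_at r dU dV dW e \<longleftrightarrow>
    (if r dvd dU \<or> r dvd dV then \<not> r dvd dW \<and> quad_res r (dW * e) else quad_res r dW)"

text \<open>As \<open>r\<close> divides \<open>\<delta>\<close> only once, U and V cannot both be
  divisible by \<open>r^2\<close>. Hence the classes \<open>dU\<close> and \<open>dV\<close> already
  show which alternative of the weak condition holds.\<close>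

lemma local_condition:
  fixes U V W :: int
  assumes r: "prime r" and y: "U * V * W = y^2"
    and U: "U = dU * A^2" and V: "V = dV * B^2" and W: "W = dW * C^2" "C \<noteq> 0"
    and \<delta>: "V - U = \<delta> * k^2" "r dvd \<delta>" "\<not> r^2 dvd \<delta>" and e: "W - U = e * k^2" "\<not> r dvd e"
    and k: "coprime U k"
  shows "admissible_at r dU dV dW e"
  using local_condition_weak[OF r y W \<delta>(1,2) e k]
proof
  assume "\<not> r dvd U \<and> \<not> r dvd V \<and> quad_res r dW"
  then show ?thesis using U V by (auto simp: admissible_at_def)
next
  assume *: "r dvd U \<and> r dvd V \<and> \<not> r dvd dW \<and> quad_res r (dW * e)"
  have "r dvd dU \<or> r dvd dV"
  proof (rule ccontr)
    assume "\<not> ?thesis"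
    then have "r dvd A" "r dvd B"
      using * U V r by (auto simp: prime_dvd_mult_iff prime_dvd_power_iff)
    then have "r^2 dvd U" "r^2 dvd V" using U V by (auto intro!: dvd_mult simp: dvd_power_same)
    then have "r^2 dvd \<delta> * k^2" using \<delta>(1) by (metis dvd_diff)
    moreover have "coprime (r^2) (k^2)"
      using k * r prime_dvd_not_coprime[of r U k] by (auto intro!: prime_imp_coprime)
    ultimately show False using \<delta>(3) by (simp add: coprime_dvd_mult_left_iff)
  qed
  then show ?thesis using * by (auto simp: admissible_at_def)
qed

text \<open>Solvability modulo 16. The variables range over residues of the squares themselves, not
  of their roots; the parity clause expresses that \<open>n\<close> and \<open>k\<close> are
  coprime.\<close>

definition admissible_at_2 :: "int \<Rightarrow> int \<Rightarrow> int \<Rightarrow> int \<Rightarrow> int \<Rightarrow> bool" where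
  "admissible_at_2 p s d1 d2 d3 \<longleftrightarrow> (\<exists>a\<in>{0,1,4,9}. \<exists>k\<in>{0,1,4,9}. (odd (d1 * a) \<or> odd k) \<and>
     (\<exists>b\<in>{0,1,4,9}. (d1 * a + p * k - d2 * b) mod 16 = 0) \<and>
     (\<exists>d\<in>{0,1,4,9}. (d1 * a + s * k - d3 * d) mod 16 = 0))"

lemma square_mod_16: "(x::int)^2 mod 16 \<in> {0,1,4,9}"
proof -
  have "x mod 16 \<in> set [0..15]" using pos_mod_bound[of 16 x] by auto
  moreover have "\<forall>z\<in>set [0..15]. (z::int)^2 mod 16 \<in> {0,1,4,9}" by code_simp
  ultimately have "(x mod 16)^2 mod 16 \<in> {0,1,4,9}" by blast
  then show ?thesis by (simp add: power_mod)
qed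

lemma local_condition_2:
  assumes "coprime n k" "n = d1 * A^2" "n + p * k^2 = d2 * B^2" "n + s * k^2 = d3 * D^2"
  shows "admissible_at_2 p s d1 d2 d3"
  unfolding admissible_at_2_def
proof (intro bexI conjI)
  have par: "even (z mod 16) \<longleftrightarrow> even z" for z :: int by presburger
  show "odd (d1 * (A^2 mod 16)) \<or> odd (k^2 mod 16)"
    using assms(1,2) by (auto simp: par dest: coprime_common_divisor[of _ _ 2])
  have "(d1 * (A^2 mod 16) + p * (k^2 mod 16) - d2 * (B^2 mod 16)) mod 16 =
    (d1 * A^2 + p * k^2 - d2 * B^2) mod 16"
    by (intro mod_diff_cong mod_add_cong mod_mult_cong) simp_all
  then show "(d1 * (A^2 mod 16) + p * (k^2 mod 16) - d2 * (B^2 mod 16)) mod 16 = 0"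
    using assms(2,3) by simp
  have "(d1 * (A^2 mod 16) + s * (k^2 mod 16) - d3 * (D^2 mod 16)) mod 16 =
    (d1 * A^2 + s * k^2 - d3 * D^2) mod 16"
    by (intro mod_diff_cong mod_add_cong mod_mult_cong) simp_all
  then show "(d1 * (A^2 mod 16) + s * (k^2 mod 16) - d3 * (D^2 mod 16)) mod 16 = 0"
    using assms(2,4) by simp
qed (rule square_mod_16)+

section \<open>Square classes of the three factors\<close>

definition divisor_list :: "int \<Rightarrow> int list" where
  "divisor_list N = filter (\<lambda>d. d dvd N) [- N..N]"

lemma mem_divisor_list:
  assumes "d dvd N" "N > 0"
  shows "d \<in> set (divisor_list N)"
  using dvd_imp_le_int[of N d] assms by (auto simp: divisor_list_def)

text \<open>Modulo squares Z equals \<open>d1 * d2\<close>, hence \<open>e1 * e2\<close> once the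
  square of the gcd is removed; the latter is squarefree.\<close>

lemma squarefree_third:
  fixes d1 d2 Z w :: int
  assumes "squarefree d1" "squarefree d2" "d1 * d2 * Z = w^2"
  obtains D where "Z = (d1 div gcd d1 d2) * (d2 div gcd d1 d2) * D^2"
proof -
  define g e1 e2 where "g = gcd d1 d2" and "e1 = d1 div g" and "e2 = d2 div g"
  have "d1 \<noteq> 0" using assms(1) by auto
  then have "g \<noteq> 0" by (simp add: g_def)
  have d: "d1 = e1 * g" "d2 = e2 * g" by (simp_all add: e1_def e2_def g_def)
  have "coprime e1 e2" using \<open>d1 \<noteq> 0\<close> unfolding e1_def e2_def g_def by (intro div_gcd_coprime) simp
  then have sf: "squarefree (e1 * e2)"
    using assms(1,2) d by (intro squarefree_mult_coprime) (auto dest: squarefree_multD)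
  have "(e1 * e2 * Z) * g^2 = w^2" using assms(3) d by (simp add: power2_eq_square algebra_simps)
  then obtain v where v: "e1 * e2 * Z = v^2" using square_cofactor \<open>g \<noteq> 0\<close> by blast
  then have "e1 * e2 dvd v" using squarefree_dvd_square[OF sf] by (metis dvd_triv_left)
  then obtain D where "v = e1 * e2 * D" by (auto simp: dvd_def)
  then have "(e1 * e2) * Z = (e1 * e2) * (e1 * e2 * D^2)" using v by algebra
  moreover have "e1 * e2 \<noteq> 0" using sf by (intro notI) simp
  ultimately have "Z = e1 * e2 * D^2" by (metis mult_cancel_left)
  then show ?thesis unfolding e1_def e2_def g_def by (rule that)
qed

text \<open>A prime divides the squarefree \<open>d\<close> exactly once, and \<open>d * T\<close>
  is a square, so each prime of \<open>d\<close> divides T as well as X.\<close>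

lemma squarefree_part_dvd:
  fixes X T :: int
  assumes "X * T = y^2" "X = d * A^2" "A \<noteq> 0" "squarefree d"
    and "\<And>l. prime l \<Longrightarrow> l dvd X \<Longrightarrow> l dvd T \<Longrightarrow> l dvd N"
  shows "d dvd N"
proof (rule squarefree_dvdI[OF assms(4)])
  fix l :: int assume l: "prime l" "l dvd d"
  have "(d * T) * A^2 = y^2" using assms(1,2) by (simp add: ac_simps)
  then obtain w where w: "d * T = w^2" using square_cofactor assms(3) by blast
  then have "l dvd w" using l by (metis dvd_mult2 prime_dvd_power)
  then have "l^2 dvd d * T" using w by (simp add: dvd_power_same)
  moreover have "\<not> l^2 dvd d"
    using assms(4) l(1) squarefreeD[OF assms(4), of l] by (meson not_prime_unit)
  ultimately have "l dvd T"
    using l(1) by (metis mult.commute prime_imp_coprime coprime_dvd_mult_left_iff coprime_power_left_iff pos2)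
  then show "l dvd N" using assms(2,5) l by auto
qed

text \<open>A common prime of two factors divides their difference and not \<open>k\<close>, which
  bounds the classes. The conditions with exponent 5 say that \<open>N1\<close> and
  \<open>N2\<close> contain all primes in question; 5 is large enough for the three curves, where
  the highest power occurring is \<open>2^5\<close>.\<close>

lemma two_descent:
  fixes p q n k y N1 N2 :: int
  assumes pq: "p > 0" "q > 0" and k: "coprime n k" and y: "y \<noteq> 0"
    and eq: "n * (n + p * k^2) * (n + (p + q) * k^2) = y^2"
    and N: "p * (p + q) dvd N1^5" "p * q dvd N2^5"
  obtains d1 d2 d3 A B D where "d1 dvd N1" "d2 dvd N2" "d1 * d2 > 0"
    "d3 = (d1 div gcd d1 d2) * (d2 div gcd d1 d2)" "A \<noteq> 0" "B \<noteq> 0" "D \<noteq> 0"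
    "n = d1 * A^2" "n + p * k^2 = d2 * B^2"
    "n + (p + q) * k^2 = d3 * D^2"
proof -
  define X Y Z where "X = n" and "Y = n + p * k^2" and "Z = n + (p + q) * k^2"
  have XYZ: "X * Y * Z = y^2" using eq by (simp add: X_def Y_def Z_def)
  have nz: "X \<noteq> 0" "Y \<noteq> 0" "Z \<noteq> 0" using XYZ y by auto
  define d1 A where "d1 = squarefree_part X" and "A = square_part X"
  define d2 B where "d2 = squarefree_part Y" and "B = square_part Y"
  have X: "X = d1 * A^2" "squarefree d1" and Y: "Y = d2 * B^2" "squarefree d2"
    unfolding d1_def A_def d2_def B_def using squarefree_decompose by auto
  have AB: "A \<noteq> 0" "B \<noteq> 0" using nz X Y by auto
  have nk: False if "prime l" "l dvd n" "l dvd k" for l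
    using k that coprime_common_divisor_int not_prime_unit by (metis coprime_common_divisor)
  have "d1 dvd N1"
  proof (rule squarefree_part_dvd[OF _ X(1) AB(1) X(2)])
    show "X * (Y * Z) = y^2" using XYZ by simp
    fix l :: int assume l: "prime l" "l dvd X" "l dvd Y * Z"
    then have "l dvd p * k^2 \<or> l dvd (p + q) * k^2"
      unfolding X_def Y_def Z_def by (simp add: prime_dvd_mult_iff dvd_add_right_iff)
    then have "l dvd p * (p + q)"
      using l nk[of l] unfolding X_def by (auto simp: prime_dvd_mult_iff prime_dvd_power_iff)
    then show "l dvd N1" using N(1) l(1) by (meson dvd_trans prime_dvd_power)
  qed
  moreover have "d2 dvd N2"
  proof (rule squarefree_part_dvd[OF _ Y(1) AB(2) Y(2)])
    show "Y * (X * Z) = y^2" using XYZ by (simp add: ac_simps)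
    fix l :: int assume l: "prime l" "l dvd Y" "l dvd X * Z"
    then have "l dvd Y - X \<or> l dvd Z - Y" by (auto simp: prime_dvd_mult_iff)
    then have "l dvd p * k^2 \<or> l dvd q * k^2"
      unfolding X_def Y_def Z_def by (simp add: algebra_simps)
    moreover have "\<not> l dvd k"
    proof
      assume "l dvd k"
      then have "l dvd p * k^2" by (simp add: power2_eq_square)
      then have "l dvd n" using l(2) unfolding Y_def by (simp add: dvd_add_left_iff)
      then show False using nk l(1) \<open>l dvd k\<close> by blast
    qed
    ultimately have "l dvd p * q"
      using l by (auto simp: prime_dvd_mult_iff prime_dvd_power_iff)
    then show "l dvd N2" using N(2) l(1) by (meson dvd_trans prime_dvd_power)
  qed
  moreover obtain D where D: "Z = (d1 div gcd d1 d2) * (d2 div gcd d1 d2) * D^2"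
  proof -
    have "(d1 * d2 * Z) * (A * B)^2 = y^2" using XYZ unfolding X(1) Y(1)
      by (simp add: power_mult_distrib ac_simps)
    then obtain w where "d1 * d2 * Z = w^2" using square_cofactor[of _ "A * B"] AB by auto
    then show ?thesis using squarefree_third[OF X(2) Y(2)] that by blast
  qed
  moreover have "d1 * d2 > 0"
  proof -
    \<comment> \<open>Z is the largest of three factors with positive product, so it is positive and
      the other two have the same sign.\<close>
    have "X \<le> Z" "Y \<le> Z" using pq unfolding X_def Y_def Z_def by (auto simp: algebra_simps)
    have "X * Y * Z > 0" using XYZ y by simp
    have "Z > 0"
    proof (rule ccontr)
      assume "\<not> Z > 0"
      then have "Z < 0" "X < 0" "Y < 0" using nz \<open>X \<le> Z\<close> \<open>Y \<le> Z\<close> by auto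
      then show False using \<open>X * Y * Z > 0\<close> by (metis mult_neg_neg mult_pos_neg order_less_asym)
    qed
    then have "X * Y > 0" using \<open>X * Y * Z > 0\<close> by (simp add: zero_less_mult_iff)
    then have "(d1 * d2) * (A * B)^2 > 0" unfolding X(1) Y(1) by (simp add: power_mult_distrib ac_simps)
    then show ?thesis by (simp add: zero_less_mult_iff)
  qed
  ultimately show ?thesis using that[of d1 d2 _ A B D] AB nz X Y by (auto simp: X_def Y_def Z_def)
qed

lemma coprime_add_mult_square:
  fixes n k p :: int
  assumes "coprime n k"
  shows "coprime (n + p * k^2) k"
  using assms gcd_add_mult[of k "p * k" n]
  by (simp add: coprime_iff_gcd_eq_1 gcd.commute power2_eq_square ac_simps)

section \<open>The classes that survive on the three curves\<close>

lemma classes_16_14: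
  fixes n k y :: int
  assumes "coprime n k" "y \<noteq> 0" "n * (n + 16 * k^2) * (n + (16 + 14) * k^2) = y^2"
  obtains d1 d2 A B where "n = d1 * A^2" "n + 16 * k^2 = d2 * B^2"
    "(d1, d2) \<in> {(1, 1), (30, 1), (- 1, - 14), (- 30, - 14)}"
proof -
  obtain d1 d2 d3 A B D where d: "d1 dvd 30" "d2 dvd 14" "d1 * d2 > 0"
      "d3 = (d1 div gcd d1 d2) * (d2 div gcd d1 d2)" "A \<noteq> 0" "B \<noteq> 0" "D \<noteq> 0"
    and eq: "n = d1 * A^2" "n + 16 * k^2 = d2 * B^2" "n + (16 + 14) * k^2 = d3 * D^2"
    by (rule two_descent[OF _ _ assms, of 30 14]) auto
  have co: "coprime (n + 16 * k^2) k" by (rule coprime_add_mult_square[OF assms(1)])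
  \<comment> \<open>The primes 3 and 5 divide 30 once, which relates the first and third factor; 7
    divides 14 once, which relates the second and third. The prime 2 is treated modulo 16.\<close>
  have "admissible_at 3 d1 d3 d2 16"
    by (rule local_condition[OF _ _ eq(1,3,2), where y = y and k = k and \<delta> = 30])
       (use assms d co in \<open>auto simp: ac_simps\<close>)
  moreover have "admissible_at 5 d1 d3 d2 16"
    by (rule local_condition[OF _ _ eq(1,3,2), where y = y and k = k and \<delta> = 30])
       (use assms d co in \<open>auto simp: ac_simps\<close>)
  moreover have "admissible_at 7 d2 d3 d1 (- 16)"
    by (rule local_condition[OF _ _ eq(2,3,1), where y = y and k = k and \<delta> = 14])
       (use assms d co in \<open>auto simp: ac_simps\<close>)
  moreover have "admissible_at_2 16 30 d1 d2 d3"
    using local_condition_2[OF assms(1) eq] by simp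
  moreover have "d1 \<in> set (divisor_list 30)" "d2 \<in> set (divisor_list 14)"
    using d by (auto intro: mem_divisor_list)
  ultimately have "(d1, d2) \<in> set (filter (\<lambda>(d1, d2). d1 * d2 > 0 \<and>
      (let d3 = (d1 div gcd d1 d2) * (d2 div gcd d1 d2) in
        admissible_at 3 d1 d3 d2 16 \<and> admissible_at 5 d1 d3 d2 16 \<and>
        admissible_at 7 d2 d3 d1 (- 16) \<and> admissible_at_2 16 30 d1 d2 d3))
      (List.product (divisor_list 30) (divisor_list 14)))"
    using d by (simp add: Let_def)
  also have "filter (\<lambda>(d1, d2). d1 * d2 > 0 \<and>
      (let d3 = (d1 div gcd d1 d2) * (d2 div gcd d1 d2) in
        admissible_at 3 d1 d3 d2 16 \<and> admissible_at 5 d1 d3 d2 16 \<and>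
        admissible_at 7 d2 d3 d1 (- 16) \<and> admissible_at_2 16 30 d1 d2 d3))
      (List.product (divisor_list 30) (divisor_list 14)) = [(-30, -14), (-1, -14), (1, 1), (30, 1)]"
    by code_simp
  finally show ?thesis using that eq by auto
qed

text \<open>The coefficients of the three differences are 12, 5 and 7, in which 3, 5 and 7 occur
  exactly once; the conditions at these primes leave four classes.\<close>

lemma classes_7_5:
  fixes n k y :: int
  assumes "coprime n k" "y \<noteq> 0" "n * (n + 7 * k^2) * (n + (7 + 5) * k^2) = y^2"
  obtains d1 d2 A B where "n = d1 * A^2" "n + 7 * k^2 = d2 * B^2"
    "(d1, d2) \<in> {(1, 1), (21, 7), (- 7, - 35), (- 3, - 5)}"
proof -
  obtain d1 d2 d3 A B D where d: "d1 dvd 42" "d2 dvd 35" "d1 * d2 > 0"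
      "d3 = (d1 div gcd d1 d2) * (d2 div gcd d1 d2)" "A \<noteq> 0" "B \<noteq> 0" "D \<noteq> 0"
    and eq: "n = d1 * A^2" "n + 7 * k^2 = d2 * B^2" "n + (7 + 5) * k^2 = d3 * D^2"
    by (rule two_descent[OF _ _ assms, of 42 35]) auto
  have co: "coprime (n + 7 * k^2) k" by (rule coprime_add_mult_square[OF assms(1)])
  have "admissible_at 3 d1 d3 d2 7"
    by (rule local_condition[OF _ _ eq(1,3,2), where y = y and k = k and \<delta> = 12])
       (use assms d co in \<open>auto simp: ac_simps\<close>)
  moreover have "admissible_at 5 d2 d3 d1 (- 7)"
    by (rule local_condition[OF _ _ eq(2,3,1), where y = y and k = k and \<delta> = 5])
       (use assms d co in \<open>auto simp: ac_simps\<close>)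
  moreover have "admissible_at 7 d1 d2 d3 12"
    by (rule local_condition[OF _ _ eq(1,2,3), where y = y and k = k and \<delta> = 7])
       (use assms d co in \<open>auto simp: ac_simps\<close>)
  moreover have "d1 \<in> set (divisor_list 42)" "d2 \<in> set (divisor_list 35)"
    using d by (auto intro: mem_divisor_list)
  ultimately have "(d1, d2) \<in> set (filter (\<lambda>(d1, d2). d1 * d2 > 0 \<and>
      (let d3 = (d1 div gcd d1 d2) * (d2 div gcd d1 d2) in
        admissible_at 3 d1 d3 d2 7 \<and> admissible_at 5 d2 d3 d1 (- 7) \<and>
        admissible_at 7 d1 d2 d3 12))
      (List.product (divisor_list 42) (divisor_list 35)))"
    using d by (simp add: Let_def)
  also have "filter (\<lambda>(d1, d2). d1 * d2 > 0 \<and>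
      (let d3 = (d1 div gcd d1 d2) * (d2 div gcd d1 d2) in
        admissible_at 3 d1 d3 d2 7 \<and> admissible_at 5 d2 d3 d1 (- 7) \<and>
        admissible_at 7 d1 d2 d3 12))
      (List.product (divisor_list 42) (divisor_list 35)) = [(-7, -35), (-3, -5), (1, 1), (21, 7)]"
    by code_simp
  finally show ?thesis using that eq by auto
qed

lemma classes_8_42:
  fixes n k y :: int
  assumes "coprime n k" "y \<noteq> 0" "n * (n + 8 * k^2) * (n + (8 + 42) * k^2) = y^2"
  obtains d1 d2 A B where "n = d1 * A^2" "n + 8 * k^2 = d2 * B^2"
    "(d1, d2) \<in> {(1, 1), (1, 2), (- 2, - 21), (- 2, - 42)}"
proof -
  obtain d1 d2 d3 A B D where d: "d1 dvd 10" "d2 dvd 42" "d1 * d2 > 0"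
      "d3 = (d1 div gcd d1 d2) * (d2 div gcd d1 d2)" "A \<noteq> 0" "B \<noteq> 0" "D \<noteq> 0"
    and eq: "n = d1 * A^2" "n + 8 * k^2 = d2 * B^2" "n + (8 + 42) * k^2 = d3 * D^2"
    by (rule two_descent[OF _ _ assms, of 10 42]) auto
  have co: "coprime (n + 8 * k^2) k" by (rule coprime_add_mult_square[OF assms(1)])
  have "admissible_at 3 d2 d3 d1 (- 8)"
    by (rule local_condition[OF _ _ eq(2,3,1), where y = y and k = k and \<delta> = 42])
       (use assms d co in \<open>auto simp: ac_simps\<close>)
  moreover have "admissible_at 7 d2 d3 d1 (- 8)"
    by (rule local_condition[OF _ _ eq(2,3,1), where y = y and k = k and \<delta> = 42])
       (use assms d co in \<open>auto simp: ac_simps\<close>)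
  \<comment> \<open>Since 25 divides 50, only the weak condition is available at 5.\<close>
  moreover have "5 dvd d1 \<longrightarrow> quad_res 5 (d2 * 8)"
    using local_condition_weak[OF _ _ eq(2) d(6), of 5 n "n + (8 + 42) * k^2" y 50 k 8] assms eq(1)
    by (auto simp: ac_simps)
  moreover have "admissible_at_2 8 50 d1 d2 d3"
    using local_condition_2[OF assms(1) eq] by simp
  moreover have "d1 \<in> set (divisor_list 10)" "d2 \<in> set (divisor_list 42)"
    using d by (auto intro: mem_divisor_list)
  ultimately have "(d1, d2) \<in> set (filter (\<lambda>(d1, d2). d1 * d2 > 0 \<and>
      (let d3 = (d1 div gcd d1 d2) * (d2 div gcd d1 d2) in
        admissible_at 3 d2 d3 d1 (- 8) \<and> admissible_at 7 d2 d3 d1 (- 8) \<and>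
        (5 dvd d1 \<longrightarrow> quad_res 5 (d2 * 8)) \<and> admissible_at_2 8 50 d1 d2 d3))
      (List.product (divisor_list 10) (divisor_list 42)))"
    using d by (simp add: Let_def)
  also have "filter (\<lambda>(d1, d2). d1 * d2 > 0 \<and>
      (let d3 = (d1 div gcd d1 d2) * (d2 div gcd d1 d2) in
        admissible_at 3 d2 d3 d1 (- 8) \<and> admissible_at 7 d2 d3 d1 (- 8) \<and>
        (5 dvd d1 \<longrightarrow> quad_res 5 (d2 * 8)) \<and> admissible_at_2 8 50 d1 d2 d3))
      (List.product (divisor_list 10) (divisor_list 42)) = [(-2, -42), (-2, -21), (1, 1), (1, 2)]"
    by code_simp
  finally show ?thesis using that eq by auto
qed

text \<open>The four cases are the images of \<open>O\<close>, \<open>(0, 0)\<close>, \<open>(-p, 0)\<close> and \<open>(-p-q, 0)\<close> under the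
  2-descent map of \<open>y\<^sup>2 = x (x + p) (x + p + q)\<close>.\<close>
definition torsion_class :: "rat \<Rightarrow> rat \<Rightarrow> rat \<Rightarrow> bool" where
  "torsion_class p q x \<longleftrightarrow>
     (\<exists>A B. x = A^2 \<and> x + p = B^2) \<or>
     (\<exists>A B. x = p * (p + q) * A^2 \<and> x + p = p * B^2) \<or>
     (\<exists>A B. x = - p * A^2 \<and> x + p = - p * q * B^2) \<or>
     (\<exists>A B. x = - (p + q) * A^2 \<and> x + p = - q * B^2)"

text \<open>In other words, the 2-descent map takes no values beyond those at the 2-torsion
  points.\<close>

definition torsion_classes_only :: "int \<Rightarrow> int \<Rightarrow> bool" where
  "torsion_classes_only p q \<longleftrightarrow>
     (\<forall>x y. y \<noteq> 0 \<and> y^2 = x * (x + of_int p) * (x + of_int p + of_int q) \<longrightarrow>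
        torsion_class (of_int p) (of_int q) x)"

text \<open>For \<open>x = n / M\<close> in lowest terms the curve equation makes
  \<open>M * T\<close> a square with M and T coprime, so M is a square \<open>k^2\<close> and T is a
  square too.\<close>

lemma torsion_classes_onlyI:
  fixes p q :: int
  assumes "\<And>n k y. coprime n k \<Longrightarrow> k \<noteq> 0 \<Longrightarrow> y \<noteq> 0 \<Longrightarrow>
      n * (n + p * k^2) * (n + (p + q) * k^2) = y^2 \<Longrightarrow>
      torsion_class (of_int p) (of_int q) (of_int n / of_int k^2)"
  shows "torsion_classes_only p q"
  unfolding torsion_classes_only_def
proof (intro allI impI, elim conjE)
  fix x y :: rat
  assume y: "y \<noteq> 0" and eq: "y^2 = x * (x + of_int p) * (x + of_int p + of_int q)"
  obtain n M where nM: "quotient_of x = (n, M)" by force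
  have M: "M > 0" and x: "x = of_int n / of_int M" and co: "coprime n M"
    using quotient_of_denom_pos[OF nM] quotient_of_div[OF nM] quotient_of_coprime[OF nM] by auto
  define T where "T = n * (n + p * M) * (n + (p + q) * M)"
  have xM: "of_int n = x * of_int M" using M by (simp add: x)
  have sqr: "of_int (M * T) = (y * of_int M^2)^2"
    unfolding T_def of_int_mult of_int_add xM using eq by algebra
  then obtain w where w: "M * T = w^2" by (rule int_square_of_rat)
  have w0: "w \<noteq> 0"
  proof
    assume "w = 0"
    then have "(y * of_int M^2)^2 = 0" unfolding sqr[symmetric] w by simp
    then show False using y M by simp
  qed
  have "coprime M T"
  proof -
    have "coprime M (n + t * M)" for t
      using co gcd_add_mult[of M t n] by (simp add: coprime_iff_gcd_eq_1 gcd.commute add.commute)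
    then show ?thesis using co unfolding T_def by (simp add: coprime_commute)
  qed
  then obtain k where k: "M = k^2" using coprime_mult_square[OF _ w M w0] by blast
  then have "k \<noteq> 0" using M by auto
  have "T * k^2 = w^2" using w k by (simp add: ac_simps)
  then obtain v where v: "T = v^2" using square_cofactor \<open>k \<noteq> 0\<close> by blast
  have "v \<noteq> 0" using v w w0 by auto
  have "coprime n k" using co k by simp
  then have "torsion_class (of_int p) (of_int q) (of_int n / of_int k^2)"
    using assms[OF _ \<open>k \<noteq> 0\<close> \<open>v \<noteq> 0\<close>] v unfolding T_def k by blast
  then show "torsion_class (of_int p) (of_int q) x" by (simp add: x k)
qed

text \<open>The squares of \<open>r\<close> and \<open>s\<close> are the factors by which the
  squarefree representatives differ from those in \<open>torsion_class\<close>.\<close>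

lemma torsion_classI:
  fixes p q n k A B d1 d2 :: int and r s :: rat
  assumes "k \<noteq> 0" "n = d1 * A^2" "n + p * k^2 = d2 * B^2"
    "(of_int d1, of_int d2) \<in> {(r^2, s^2), (of_int (p * (p + q)) * r^2, of_int p * s^2),
       (of_int (- p) * r^2, of_int (- p * q) * s^2), (of_int (- (p + q)) * r^2, of_int (- q) * s^2)}"
  shows "torsion_class (of_int p) (of_int q) (of_int n / of_int k^2)"
proof -
  define x :: rat where "x = of_int n / of_int k^2"
  have x: "x = of_int d1 * (of_int A / of_int k)^2"
    using assms(2) by (simp add: x_def power_divide)
  have "x + of_int p = of_int (n + p * k^2) / of_int k^2"
    using assms(1) by (simp add: x_def add_divide_distrib)
  then have xp: "x + of_int p = of_int d2 * (of_int B / of_int k)^2"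
    unfolding assms(3) by (simp add: power_divide)
  have *: "\<exists>A' B'. x = c1 * A'^2 \<and> x + of_int p = c2 * B'^2"
    if "of_int d1 = c1 * r^2" "of_int d2 = c2 * s^2" for c1 c2
  proof -
    have "x = c1 * (r * (of_int A / of_int k))^2"
      unfolding x that power_mult_distrib by (simp only: mult.assoc)
    moreover have "x + of_int p = c2 * (s * (of_int B / of_int k))^2"
      unfolding xp that power_mult_distrib by (simp only: mult.assoc)
    ultimately show ?thesis by blast
  qed
  show ?thesis
    using assms(4) *[of 1 1] *[of "of_int (p * (p + q))" "of_int p"]
      *[of "of_int (- p)" "of_int (- p * q)"] *[of "of_int (- (p + q))" "of_int (- q)"]
    unfolding torsion_class_def x_def by auto
qed

lemma torsion_classes_only_16_14: "torsion_classes_only 16 14"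
proof (rule torsion_classes_onlyI)
  fix n k y :: int
  assume *: "coprime n k" "k \<noteq> 0" "y \<noteq> 0" "n * (n + 16 * k^2) * (n + (16 + 14) * k^2) = y^2"
  show "torsion_class (of_int 16) (of_int 14) (of_int n / of_int k^2)"
  proof (rule classes_16_14[OF *(1,3,4)])
    fix d1 d2 A B
    assume d: "n = d1 * A^2" "n + 16 * k^2 = d2 * B^2"
      and "(d1, d2) \<in> {(1, 1), (30, 1), (- 1, - 14), (- 30, - 14)}"
    then consider "d1 = 1" "d2 = 1" | "d1 = 30" "d2 = 1" | "d1 = - 1" "d2 = - 14"
      | "d1 = - 30" "d2 = - 14" by auto
    then show ?thesis
    proof cases
      case 1 show ?thesis by (rule torsion_classI[OF *(2) d, of 1 1]) (simp add: 1)
    next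
      case 2 show ?thesis
        by (rule torsion_classI[OF *(2) d, of "1/4" "1/4"]) (simp add: 2 power2_eq_square)
    next
      case 3 show ?thesis
        by (rule torsion_classI[OF *(2) d, of "1/4" "1/4"]) (simp add: 3 power2_eq_square)
    next
      case 4 show ?thesis by (rule torsion_classI[OF *(2) d, of 1 1]) (simp add: 4)
    qed
  qed
qed

lemma torsion_classes_only_7_5: "torsion_classes_only 7 5"
proof (rule torsion_classes_onlyI)
  fix n k y :: int
  assume *: "coprime n k" "k \<noteq> 0" "y \<noteq> 0" "n * (n + 7 * k^2) * (n + (7 + 5) * k^2) = y^2"
  show "torsion_class (of_int 7) (of_int 5) (of_int n / of_int k^2)"
  proof (rule classes_7_5[OF *(1,3,4)])
    fix d1 d2 A B
    assume d: "n = d1 * A^2" "n + 7 * k^2 = d2 * B^2"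
      and "(d1, d2) \<in> {(1, 1), (21, 7), (- 7, - 35), (- 3, - 5)}"
    then consider "d1 = 1" "d2 = 1" | "d1 = 21" "d2 = 7" | "d1 = - 7" "d2 = - 35"
      | "d1 = - 3" "d2 = - 5" by auto
    then show ?thesis
    proof cases
      case 1 show ?thesis by (rule torsion_classI[OF *(2) d, of 1 1]) (simp add: 1)
    next
      case 2 show ?thesis
        by (rule torsion_classI[OF *(2) d, of "1/2" 1]) (simp add: 2 power2_eq_square)
    next
      case 3 show ?thesis by (rule torsion_classI[OF *(2) d, of 1 1]) (simp add: 3)
    next
      case 4 show ?thesis
        by (rule torsion_classI[OF *(2) d, of "1/2" 1]) (simp add: 4 power2_eq_square)
    qed
  qed
qed

lemma torsion_classes_only_8_42: "torsion_classes_only 8 42"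
proof (rule torsion_classes_onlyI)
  fix n k y :: int
  assume *: "coprime n k" "k \<noteq> 0" "y \<noteq> 0" "n * (n + 8 * k^2) * (n + (8 + 42) * k^2) = y^2"
  show "torsion_class (of_int 8) (of_int 42) (of_int n / of_int k^2)"
  proof (rule classes_8_42[OF *(1,3,4)])
    fix d1 d2 A B
    assume d: "n = d1 * A^2" "n + 8 * k^2 = d2 * B^2"
      and "(d1, d2) \<in> {(1, 1), (1, 2), (- 2, - 21), (- 2, - 42)}"
    then consider "d1 = 1" "d2 = 1" | "d1 = 1" "d2 = 2" | "d1 = - 2" "d2 = - 21"
      | "d1 = - 2" "d2 = - 42" by auto
    then show ?thesis
    proof cases
      case 1 show ?thesis by (rule torsion_classI[OF *(2) d, of 1 1]) (simp add: 1)
    next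
      \<comment> \<open>Here \<open>p * (p + q) = 400\<close> and \<open>p = 8\<close>, so
        \<open>1 = 400 / 20^2\<close> and \<open>2 = 8 / 2^2\<close>.\<close>
      case 2 show ?thesis
        by (rule torsion_classI[OF *(2) d, of "1/20" "1/2"]) (simp add: 2 power2_eq_square)
    next
      case 3 show ?thesis
        by (rule torsion_classI[OF *(2) d, of "1/2" "1/4"]) (simp add: 3 power2_eq_square)
    next
      case 4 show ?thesis
        by (rule torsion_classI[OF *(2) d, of "1/5" 1]) (simp add: 4 power2_eq_square)
    qed
  qed
qed

section \<open>Infinite descent\<close>

text \<open>Euler's concordant forms: \<open>a^2 + p * c^2\<close> and
  \<open>a^2 + (p + q) * c^2\<close> are squares together with \<open>a^2\<close>. For nonzero
  \<open>c\<close> this is a point on the curve whose three factors are all squares.\<close>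

definition concordant :: "'a::comm_ring_1 \<Rightarrow> 'a \<Rightarrow> 'a \<Rightarrow> 'a \<Rightarrow> 'a \<Rightarrow> 'a \<Rightarrow> bool" where
  "concordant p q a b d c \<longleftrightarrow> b^2 = a^2 + p * c^2 \<and> d^2 = b^2 + q * c^2"

lemma concordant_divide:
  fixes p q a b d c :: int
  assumes "concordant p q a b d c" "c \<noteq> 0" "\<not> coprime a c"
  obtains a' b' d' c' where "concordant p q a' b' d' c'" "c' \<noteq> 0" "\<bar>c'\<bar> < \<bar>c\<bar>"
proof -
  define g where "g = gcd a c"
  have g: "g > 1" using assms(2,3) unfolding g_def coprime_iff_gcd_eq_1
    by (metis gcd_pos_int int_one_le_iff_zero_less order_le_less)
  obtain a' c' where ac: "a = g * a'" "c = g * c'" unfolding g_def by (meson dvdE gcd_dvd1 gcd_dvd2)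
  have eqs: "b^2 = g^2 * (a'^2 + p * c'^2)" "d^2 = b^2 + g^2 * (q * c'^2)"
    using assms(1) unfolding concordant_def ac by algebra+
  have "g dvd b" using eqs(1) by (metis dvd_triv_left pow_divides_pow_iff zero_less_numeral)
  then obtain b' where b: "b = g * b'" by (auto simp: dvd_def)
  have "d^2 = g^2 * (b'^2 + q * c'^2)" using eqs(2) unfolding b by algebra
  then have "g dvd d" by (metis dvd_triv_left pow_divides_pow_iff zero_less_numeral)
  then obtain d' where d: "d = g * d'" by (auto simp: dvd_def)
  have "g^2 * b'^2 = g^2 * (a'^2 + p * c'^2)" "g^2 * d'^2 = g^2 * (b'^2 + q * c'^2)"
    using eqs unfolding b d by algebra+
  then have "concordant p q a' b' d' c'" using g unfolding concordant_def by simp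
  moreover have "c' \<noteq> 0" using assms(2) ac by auto
  moreover have "\<bar>c'\<bar> < \<bar>c\<bar>" using g \<open>c' \<noteq> 0\<close> ac(2) by (simp add: abs_mult)
  ultimately show ?thesis by (rule that)
qed

lemma rat_square_third:
  fixes u v w :: rat
  assumes "u * v = \<alpha>^2" "u * w = \<beta>^2" "u \<noteq> 0"
  shows "v * w = (\<alpha> * \<beta> / u)^2"
proof -
  have "(\<alpha> * \<beta>)^2 = v * w * u^2" using assms(1,2) by algebra
  then show ?thesis using assms(3) by (simp add: power_divide)
qed

lemma pairwise_squares:
  fixes a b d :: int
  assumes "of_int ((a + b) * (a + d)) = (\<alpha>::rat)^2" "of_int ((a + b) * (b + d)) = (\<beta>::rat)^2"
    "a + b \<noteq> 0"
  shows "\<exists>A B D. (a + b) * (a + d) = A^2 \<and> (a + b) * (b + d) = B^2 \<and> (a + d) * (b + d) = D^2"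
proof -
  have "of_int (a + d) * of_int (b + d) = (\<alpha> * \<beta> / of_int (a + b))^2"
    by (rule rat_square_third[OF assms(1,2)[unfolded of_int_mult]])
       (use assms(3) in \<open>simp only: of_int_eq_0_iff not_False_eq_True\<close>)
  then have ad: "of_int ((a + d) * (b + d)) = (\<alpha> * \<beta> / of_int (a + b))^2" by simp
  obtain A B D where "(a + b) * (a + d) = A^2" "(a + b) * (b + d) = B^2" "(a + d) * (b + d) = D^2"
    using int_square_of_rat[OF assms(1)] int_square_of_rat[OF assms(2)] int_square_of_rat[OF ad] by metis
  then show ?thesis by blast
qed

text \<open>A solution gives the point \<open>x = (a + b) (a + d) / c\<^sup>2\<close>, one of the halves of the point with
  \<open>x = a\<^sup>2 / c\<^sup>2\<close>; changing one sign translates it by a point of order two.\<close>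
lemma concordant_signs:
  fixes p q a b d c :: int
  assumes tc: "torsion_classes_only p q" and pq: "p \<noteq> 0" "q \<noteq> 0" "p + q \<noteq> 0"
    and con: "concordant p q a b d c" and c: "c \<noteq> 0"
  obtains a1 b1 d1 A B D where "concordant p q a1 b1 d1 c"
    "(a1 + b1) * (a1 + d1) = A^2" "(a1 + b1) * (b1 + d1) = B^2" "(a1 + d1) * (b1 + d1) = D^2"
proof -
  have con': "concordant p q (- a) b d c" "concordant p q a (- b) d c" "concordant p q a b (- d) c"
    using con by (simp_all add: concordant_def)
  define C P Q u v w :: rat where defs: "C = of_int c" "P = of_int p" "Q = of_int q"
    "u = of_int (a + b)" "v = of_int (a + d)" "w = of_int (b + d)"
  \<comment> \<open>The cofactors of \<open>u\<close>, \<open>v\<close>, \<open>w\<close> in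
    \<open>P * C^2\<close>, \<open>(P + Q) * C^2\<close>, \<open>Q * C^2\<close>. Changing the sign
    of \<open>a\<close>, \<open>b\<close> or \<open>d\<close> exchanges two of \<open>u\<close>,
    \<open>v\<close>, \<open>w\<close> with their cofactors, up to sign.\<close>
  define u' v' w' :: rat where defs': "u' = of_int (b - a)" "v' = of_int (d - a)" "w' = of_int (d - b)"
  have nz: "C \<noteq> 0" "P \<noteq> 0" "Q \<noteq> 0" "P + Q \<noteq> 0"
    using c pq by (simp_all add: defs flip: of_int_add)
  have int: "(a + b) * (b - a) = p * c^2" "(a + d) * (d - a) = (p + q) * c^2"
    "(b + d) * (d - b) = q * c^2"
    using con unfolding concordant_def by algebra+
  have prod: "u * u' = P * C^2" "v * v' = (P + Q) * C^2" "w * w' = Q * C^2"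
    using int[THEN arg_cong, of "of_int :: int \<Rightarrow> rat"] unfolding defs defs' by simp_all
  have rel: "w - v = u'" "w - u = v'" "v - u = w'" unfolding defs defs' by simp_all
  have uvw: "u \<noteq> 0" "v \<noteq> 0" "w \<noteq> 0" "u' \<noteq> 0" using prod nz by auto
  define x where "x = u * v / C^2"
  have x: "x * C^2 = u * v" using nz by (simp add: x_def)
  have xp: "(x + P) * C^2 = u * w" using x prod rel by algebra
  have xpq: "(x + P + Q) * C^2 = v * w" using xp prod rel by algebra
  have "(u * v * w / C^3)^2 = x * (x + P) * (x + P + Q)"
  proof -
    have "x * (x + P) * (x + P + Q) * (C^3)^2 = (u * v * w)^2" using x xp xpq by algebra
    then show ?thesis using nz by (simp add: power_divide nonzero_divide_eq_eq)
  qed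
  moreover have "u * v * w / C^3 \<noteq> 0" using uvw nz by simp
  ultimately have "torsion_class P Q x"
    using tc unfolding torsion_classes_only_def defs by blast
  \<comment> \<open>The four classes are answered by no sign change and by changing the sign of
    \<open>a\<close>, \<open>b\<close>, \<open>d\<close>, in this order.\<close>
  then consider A B where "x = A^2" "x + P = B^2"
    | A B where "x = P * (P + Q) * A^2" "x + P = P * B^2"
    | A B where "x = - P * A^2" "x + P = - P * Q * B^2"
    | A B where "x = - (P + Q) * A^2" "x + P = - Q * B^2"
    unfolding torsion_class_def by blast
  then show ?thesis
  proof cases
    case (1 A B)
    have "u * v = (A * C)^2" "u * w = (B * C)^2"
      using x xp 1 by algebra+
    then have "\<exists>A B D. (a + b) * (a + d) = A^2 \<and> (a + b) * (b + d) = B^2 \<and> (a + d) * (b + d) = D^2"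
      using uvw(1) unfolding defs by (intro pairwise_squares) simp_all
    then show ?thesis using that[of a b d] con by blast
  next
    case (2 A B)
    have "A \<noteq> 0" using 2(1) x uvw nz by auto
    have "P * (P + Q) * C^2 * (A^2 * (u' * v')) = P * (P + Q) * C^2 * C^2"
      using x prod 2(1) by algebra
    then have "A^2 * (u' * v') = C^2" using nz by simp
    then have e1: "u' * v' = (C / A)^2" using \<open>A \<noteq> 0\<close> by (simp add: power_divide field_simps)
    have "u' * w * u^2 = (P * B * C^2)^2" using xp prod 2(2) by algebra
    then have e2: "u' * w = (P * B * C^2 / u)^2"
      using uvw by (simp add: power_divide nonzero_eq_divide_eq)
    have "\<exists>A B D. (- a + b) * (- a + d) = A^2 \<and> (- a + b) * (b + d) = B^2 \<and> (- a + d) * (b + d) = D^2"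
      using e1 e2 uvw(4) unfolding defs defs' by (intro pairwise_squares) simp_all
    then show ?thesis using that[of "- a" b d] con' by auto
  next
    case (3 A B)
    have "B \<noteq> 0" using 3(2) xp uvw nz by auto
    have "u' * v * u^2 = - ((P * A * C^2)^2)" using x prod 3(1) by algebra
    then have e1: "- u' * v = (P * A * C^2 / u)^2"
      using uvw by (simp add: power_divide nonzero_eq_divide_eq)
    have "P * Q * C^2 * (B^2 * (- u' * w')) = P * Q * C^2 * C^2"
      using xp prod 3(2) by algebra
    moreover have "P * Q * C^2 \<noteq> 0" using nz by simp
    ultimately have "B^2 * (- u' * w') = C^2" using mult_left_cancel by blast
    then have e2: "- u' * w' = (C / B)^2" using \<open>B \<noteq> 0\<close> by (simp add: power_divide field_simps)
    have "\<exists>A B D. (a + - b) * (a + d) = A^2 \<and> (a + - b) * (- b + d) = B^2 \<and> (a + d) * (- b + d) = D^2"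
      using e1 e2 uvw(4) unfolding defs defs' by (intro pairwise_squares) simp_all
    then show ?thesis using that[of a "- b" d] con' by auto
  next
    case (4 A B)
    have "u * v' * v^2 = - (((P + Q) * A * C^2)^2)" using x prod 4(1) by algebra
    then have e1: "u * - v' = ((P + Q) * A * C^2 / v)^2"
      using uvw by (simp add: power_divide nonzero_eq_divide_eq)
    have "u * w' * w^2 = - ((Q * B * C^2)^2)" using xp prod 4(2) by algebra
    then have e2: "u * - w' = (Q * B * C^2 / w)^2"
      using uvw by (simp add: power_divide nonzero_eq_divide_eq)
    have "\<exists>A B D. (a + b) * (a + - d) = A^2 \<and> (a + b) * (b + - d) = B^2 \<and> (a + - d) * (b + - d) = D^2"
      using e1 e2 uvw(1) unfolding defs defs' by (intro pairwise_squares) simp_all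
    then show ?thesis using that[of a b "- d"] con' by auto
  qed
qed

text \<open>The three square roots A, B, D form a solution with the same \<open>c\<close>, because
  \<open>(a + b) * (b - a) = p * c^2\<close> and \<open>(b + d) * (d - b) = q * c^2\<close>. The
  descent comes from common factors: for minimal \<open>c\<close> every solution is primitive, while
  \<open>prim\<close> makes the new one imprimitive.\<close>

lemma concordant_int_trivial:
  fixes p q a b d c :: int
  assumes tc: "torsion_classes_only p q" and pq: "p \<noteq> 0" "q \<noteq> 0" "p + q \<noteq> 0"
    and prim: "\<And>a b d c A B D :: int. concordant p q a b d c \<Longrightarrow> c \<noteq> 0 \<Longrightarrow> coprime a c \<Longrightarrow>
      (a + b) * (a + d) = A^2 \<Longrightarrow> (a + b) * (b + d) = B^2 \<Longrightarrow> (a + d) * (b + d) = D^2 \<Longrightarrow>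
      \<not> coprime A c"
    and "concordant p q a b d c"
  shows "c = 0"
  using assms(6)
proof (induction "nat \<bar>c\<bar>" arbitrary: a b d c rule: less_induct)
  case less
  show ?case
  proof (rule ccontr)
    assume c: "c \<noteq> 0"
    have smaller: "coprime a' c" if con: "concordant p q a' b' d' c" for a' b' d'
    proof (rule ccontr)
      assume "\<not> coprime a' c"
      then obtain a'' b'' d'' c' where "concordant p q a'' b'' d'' c'" "c' \<noteq> 0" "\<bar>c'\<bar> < \<bar>c\<bar>"
        using concordant_divide[OF con c] by blast
      then show False using less.hyps[of c'] by simp
    qed
    obtain a1 b1 d1 A B D where s: "concordant p q a1 b1 d1 c"
      "(a1 + b1) * (a1 + d1) = A^2" "(a1 + b1) * (b1 + d1) = B^2" "(a1 + d1) * (b1 + d1) = D^2"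
      using concordant_signs[OF tc pq less.prems c] by blast
    have "concordant p q A B D c"
      using s unfolding concordant_def by algebra
    then have "coprime A c" by (rule smaller)
    moreover have "coprime a1 c" by (rule smaller[OF s(1)])
    ultimately show False using prim[OF s(1) c _ s(2-4)] by blast
  qed
qed

section \<open>From concordant quadruples to rational points\<close>

lemma common_denominator:
  fixes x y z w :: rat
  obtains N x' y' z' w' :: int where "N \<noteq> 0" "of_int x' = of_int N * x" "of_int y' = of_int N * y"
    "of_int z' = of_int N * z" "of_int w' = of_int N * w"
proof -
  have *: "\<exists>m u. m \<noteq> 0 \<and> of_int u = of_int m * r" for r :: rat
    by (metis quotient_of_div quotient_of_denom_pos prod.exhaust nonzero_mult_div_cancel_left
        of_int_eq_0_iff order_less_irrefl times_divide_eq_right)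
  obtain m1 u1 m2 u2 m3 u3 m4 u4 where m: "m1 \<noteq> 0" "m2 \<noteq> 0" "m3 \<noteq> 0" "m4 \<noteq> 0"
    and u: "of_int u1 = of_int m1 * x" "of_int u2 = of_int m2 * y"
      "of_int u3 = of_int m3 * z" "of_int u4 = of_int m4 * w"
    using *[of x] *[of y] *[of z] *[of w] by blast
  show ?thesis
    by (rule that[of "m1 * m2 * m3 * m4" "u1 * m2 * m3 * m4" "m1 * u2 * m3 * m4"
          "m1 * m2 * u3 * m4" "m1 * m2 * m3 * u4"]) (use m u in auto)
qed

lemma concordant_rat_trivial:
  fixes p q :: int and a b d c :: rat
  assumes "\<And>a b d c :: int. concordant p q a b d c \<Longrightarrow> c = 0"
    and "concordant (of_int p) (of_int q) a b d c"
  shows "c = 0"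
proof -
  obtain N a' b' d' c' :: int where N: "N \<noteq> 0" and e: "of_int a' = of_int N * a"
    "of_int b' = of_int N * b" "of_int d' = of_int N * d" "of_int c' = of_int N * c"
    by (rule common_denominator)
  have "(of_int b')^2 = (of_int a')^2 + of_int p * (of_int c' :: rat)^2"
    "(of_int d')^2 = (of_int b')^2 + of_int q * (of_int c' :: rat)^2"
    using assms(2) unfolding concordant_def e by algebra+
  then have "of_int (b'^2) = (of_int (a'^2 + p * c'^2) :: rat)"
    "of_int (d'^2) = (of_int (b'^2 + q * c'^2) :: rat)" by simp_all
  then have "concordant p q a' b' d' c'" unfolding concordant_def of_int_eq_iff by simp
  then have "c' = 0" by (rule assms(1))
  then show ?thesis using e(4) N by simp
qed

text \<open>Adding the 2-torsion point of the same class gives a point with trivial class, that is,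
  a concordant quadruple. For (0, 0), (-p, 0) and (-p-q, 0) the translate has \<open>x\<close>,
  \<open>x + p\<close>, respectively \<open>x + p + q\<close>, equal to the inverse of a square,
  which accounts for the entry 1.\<close>

lemma no_points_off_two_torsion:
  fixes p q :: int and x y :: rat
  assumes tc: "torsion_classes_only p q" and pq: "p \<noteq> 0" "q \<noteq> 0" "p + q \<noteq> 0"
    and triv: "\<And>a b d c :: int. concordant p q a b d c \<Longrightarrow> c = 0"
    and eq: "y^2 = x * (x + of_int p) * (x + of_int p + of_int q)"
  shows "y = 0"
proof (rule ccontr)
  assume y: "y \<noteq> 0"
  define P Q :: rat where PQ: "P = of_int p" "Q = of_int q"
  have nz: "P \<noteq> 0" "Q \<noteq> 0" "P + Q \<noteq> 0" using pq by (simp_all add: PQ flip: of_int_add)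
  have no: "c = 0" if "concordant P Q a b d c" for a b d c
    by (rule concordant_rat_trivial[of p q a b d c]) (use triv that in \<open>auto simp: PQ\<close>)
  have eq': "y^2 = x * (x + P) * (x + P + Q)" using eq by (simp add: PQ)
  have x0: "x \<noteq> 0" "x + P \<noteq> 0" using y eq' by auto
  have "torsion_class P Q x"
    using tc y eq unfolding torsion_classes_only_def PQ by blast
  then consider A B where "x = A^2" "x + P = B^2"
    | A B where "x = P * (P + Q) * A^2" "x + P = P * B^2"
    | A B where "x = - P * A^2" "x + P = - P * Q * B^2"
    | A B where "x = - (P + Q) * A^2" "x + P = - Q * B^2"
    unfolding torsion_class_def by blast
  then show False
  proof cases
    case (1 A B)
    have "(x + P + Q) * (A * B)^2 = y^2" using eq' 1 by algebra
    moreover have "A * B \<noteq> 0" using 1 x0 by auto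
    ultimately have "(y / (A * B))^2 = B^2 + Q" using 1 by (simp add: power_divide nonzero_divide_eq_eq)
    then have "concordant P Q A B (y / (A * B)) 1" using 1 by (simp add: concordant_def)
    then show False using no by fastforce
  next
    case (2 A B)
    have AB: "A \<noteq> 0" "B \<noteq> 0" using 2 x0 by auto
    define D where "D = y / (P * (P + Q) * A * B)"
    have D: "y = D * (P * (P + Q) * A * B)" using AB nz by (simp add: D_def)
    have "(P * A * B)^2 * (P + Q) * ((P + Q) * D^2) = (P * A * B)^2 * (P + Q) * (x + P + Q)"
      using eq' 2 D by algebra
    moreover have "(P * A * B)^2 * (P + Q) \<noteq> 0" using AB nz by simp
    ultimately have "(P + Q) * D^2 = x + P + Q" using mult_left_cancel by blast
    then have "(P + Q) * D^2 = (P + Q) * (1 + P * A^2)" using 2(1) by algebra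
    then have "D^2 = 1 + P * A^2" using nz by (metis mult_cancel_left)
    moreover have "P * B^2 = P * (1 + (P + Q) * A^2)" using 2 by algebra
    then have "B^2 = 1 + (P + Q) * A^2" using nz by (metis mult_cancel_left)
    ultimately have "concordant P Q 1 D B A" by (simp add: concordant_def algebra_simps)
    then show False using no AB by blast
  next
    case (3 A B)
    have AB: "A \<noteq> 0" "B \<noteq> 0" using 3 x0 by auto
    define D where "D = y / (P * Q * A * B)"
    have D: "y = D * (P * Q * A * B)" using AB nz by (simp add: D_def)
    have "(P * A * B)^2 * Q * (Q * D^2) = (P * A * B)^2 * Q * (x + P + Q)"
      using eq' 3 D by algebra
    then have "Q * D^2 = x + P + Q" using AB nz by simp
    then have "Q * D^2 = Q * (1 - P * B^2)" using 3(2) by algebra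
    then have "D^2 = 1 - P * B^2" using nz by (metis mult_cancel_left)
    moreover have "P * A^2 = P * (1 + Q * B^2)" using 3 by algebra
    then have "A^2 = 1 + Q * B^2" using nz by (metis mult_cancel_left)
    ultimately have "concordant P Q D 1 A B" by (simp add: concordant_def algebra_simps)
    then show False using no AB by blast
  next
    case (4 A B)
    have AB: "A \<noteq> 0" "B \<noteq> 0" using 4 x0 by auto
    define D where "D = y / (Q * (P + Q) * A * B)"
    have D: "y = D * (Q * (P + Q) * A * B)" using AB nz by (simp add: D_def)
    have "D \<noteq> 0" using D y by auto
    have "(A * B)^2 * (Q * (P + Q)) * (Q * (P + Q) * D^2) = (A * B)^2 * (Q * (P + Q)) * (x + P + Q)"
      using eq' 4 D by algebra
    then have z: "Q * (P + Q) * D^2 = x + P + Q" using AB nz by simp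
    have "(P + Q) * A^2 = (P + Q) * (1 - Q * D^2)" using 4(1) z by algebra
    then have "A^2 = 1 - Q * D^2" using nz by (metis mult_cancel_left)
    moreover have "Q * B^2 = Q * (1 - (P + Q) * D^2)" using 4(2) z by algebra
    then have "B^2 = 1 - (P + Q) * D^2" using nz by (metis mult_cancel_left)
    ultimately have "concordant P Q B A 1 D" by (simp add: concordant_def algebra_simps)
    then show False using no \<open>D \<noteq> 0\<close> by blast
  qed
qed

section \<open>Common factors after halving\<close>

lemma concordant_half_not_coprime:
  fixes p q a b d c A :: int
  assumes "even p" "q mod 4 = 2" "concordant p q a b d c" "coprime a c" "(a + b) * (a + d) = A^2"
  shows "\<not> coprime A c"
proof -
  have eqs: "b^2 = a^2 + p * c^2" "d^2 = b^2 + q * c^2"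
    using assms(3) by (auto simp: concordant_def)
  \<comment> \<open>For odd \<open>c\<close> the difference \<open>d^2 - b^2\<close> would be 2
    modulo 4. So \<open>c\<close> is even, \<open>a\<close> and \<open>b\<close> are odd, and 2 is a
    common factor of A and \<open>c\<close>.\<close>
  have "even c"
  proof (rule ccontr)
    assume "odd c"
    have sq: "z^2 mod 4 = (if even z then 0 else 1)" for z :: int
    proof (cases "even z")
      case True
      then obtain k where "z = 2 * k" by (auto elim: evenE)
      then show ?thesis by (simp add: power_mult_distrib)
    next
      case False
      then obtain k where "z = 2 * k + 1" by (auto elim: oddE)
      then have "z^2 = 1 + 4 * (k^2 + k)" by algebra
      then have "z^2 mod 4 = 1 mod 4" by (simp only: mod_mult_self2)
      then show ?thesis using False by simp
    qed
    have "c^2 mod 4 = 1" using sq[of c] \<open>odd c\<close> by simp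
    then have "(q * c^2) mod 4 = 2" using assms(2) mod_mult_cong[of q 4 2 "c^2" 1] by simp
    then have "(d^2 - b^2) mod 4 = 2" using eqs(2) by simp
    moreover have "(d^2 - b^2) mod 4 = (d^2 mod 4 - b^2 mod 4) mod 4" by (simp add: mod_diff_eq)
    ultimately show False using sq[of d] sq[of b] by (auto split: if_splits)
  qed
  then have "odd a" using assms(4) coprime_common_divisor[of a c 2] by auto
  have "odd (b^2)" using eqs(1) \<open>odd a\<close> \<open>even c\<close> by simp
  then have "even (A^2)" using assms(5) \<open>odd a\<close> by (metis even_add even_mult_iff even_power zero_less_numeral)
  then show ?thesis using \<open>even c\<close> coprime_common_divisor[of A c 2] by auto
qed

text \<open>If A were coprime to \<open>c\<close>, so would be \<open>a + b\<close> and
  \<open>b + d\<close>; hence they divide 7 and 5. Their product is a square only if they are equal,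
  and then \<open>a = d\<close> forces \<open>c = 0\<close>.\<close>

lemma concordant_7_5_half_not_coprime:
  fixes a b d c A B :: int
  assumes con: "concordant 7 5 a b d c" and c: "c \<noteq> 0"
    and A: "(a + b) * (a + d) = A^2" and B: "(a + b) * (b + d) = B^2"
  shows "\<not> coprime A c"
proof
  assume co: "coprime A c"
  have eqs: "(a + b) * (b - a) = c^2 * 7" "(b + d) * (d - b) = c^2 * 5"
    using con unfolding concordant_def by algebra+
  have "coprime (A^2) (c^2)" using co by simp
  then have "coprime (a + b) (c^2)" unfolding A[symmetric] by simp
  then have "a + b dvd 7" using eqs(1) by (metis coprime_dvd_mult_right_iff dvd_triv_left)
  have "B^2 = A^2 + 7 * c^2" using A B eqs(1) by algebra
  then have "coprime (B^2) c" using coprime_add_mult_square[of "A^2" c 7] co by simp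
  then have "coprime (b + d) (c^2)" unfolding B[symmetric] by simp
  then have "b + d dvd 5" using eqs(2) by (metis coprime_dvd_mult_right_iff dvd_triv_left)
  have "a + b \<in> set (divisor_list 7)" "b + d \<in> set (divisor_list 5)"
    using \<open>a + b dvd 7\<close> \<open>b + d dvd 5\<close> by (auto intro: mem_divisor_list)
  moreover have "divisor_list 7 = [- 7, - 1, 1, 7]" "divisor_list 5 = [- 5, - 1, 1, 5]"
    by code_simp+
  \<comment> \<open>Unequal divisors give a product in this list, whose members are negative or not
    squares modulo 16.\<close>
  ultimately have "a + b = b + d \<or> B^2 \<in> {- 35, - 7, - 5, - 1, 5, 7, 35}"
    unfolding B[symmetric] by auto
  then have "a + b = b + d"
  proof
    assume "B^2 \<in> {- 35, - 7, - 5, - 1, 5, 7, 35}"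
    moreover obtain S where "S = B^2" "S \<ge> 0" "S mod 16 \<in> {0, 1, 4, 9}"
      using square_mod_16[of B] by simp
    ultimately show ?thesis by auto
  qed
  then have "c^2 * 12 = 0" using eqs by algebra
  then show False using c by simp
qed

lemma concordant_16_14: "concordant 16 14 a b d (c::int) \<Longrightarrow> c = 0"
  by (rule concordant_int_trivial[OF torsion_classes_only_16_14])
     (use concordant_half_not_coprime[of 16 14] in auto)

lemma concordant_8_42: "concordant 8 42 a b d (c::int) \<Longrightarrow> c = 0"
  by (rule concordant_int_trivial[OF torsion_classes_only_8_42])
     (use concordant_half_not_coprime[of 8 42] in auto)

lemma concordant_7_5: "concordant 7 5 a b d (c::int) \<Longrightarrow> c = 0"
  by (rule concordant_int_trivial[OF torsion_classes_only_7_5])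
     (use concordant_7_5_half_not_coprime in auto)

section \<open>Rational points on the three quartics\<close>

lemma quartic_P:
  fixes m s :: rat
  assumes "s^2 = 8 * m * (m + 2) * (m + 3) * (m + 7)"
  shows "s = 0"
proof (cases "m = 0")
  case False
  \<comment> \<open>This Moebius map sends the roots 0, -7, -3, -2 to infinity, 0, -16, -30; the
    scaling of \<open>s\<close> uses \<open>12 * 28 * 42 = 8 * 42^2\<close>.\<close>
  define x where "x = 12 * (m + 7) / m"
  have x0: "x * m = 12 * (m + 7)" using False x_def by (metis nonzero_divide_eq_eq)
  then have x: "(x + 16) * m = 28 * (m + 3)" "(x + 16 + 14) * m = 42 * (m + 2)"
    by algebra+
  have "(x * (x + 16) * (x + 16 + 14)) * (m^2)^2 = (42 * s)^2" using x0 x assms by algebra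
  then have "(42 * s / m^2)^2 = x * (x + of_int 16) * (x + of_int 16 + of_int 14)"
    using False by (simp add: power_divide nonzero_divide_eq_eq)
  then have "42 * s / m^2 = 0"
    by (intro no_points_off_two_torsion[OF torsion_classes_only_16_14 _ _ _ concordant_16_14]) auto
  then show ?thesis using False by simp
qed (use assms in auto)

lemma quartic_Q:
  fixes m s :: rat
  assumes "s^2 = - ((m + 1) * (m + 3) * (m + 5) * (m - 9))"
  shows "s = 0"
proof (cases "m + 1 = 0")
  case False
  define k where "k = m + 1"
  have k: "k \<noteq> 0" "m = k - 1" using False by (simp_all add: k_def)
  \<comment> \<open>The roots -1, 9, -5, -3 go to infinity, 0, -7, -12.\<close>
  define x where "x = 2 * (10 - k) / k"
  have x0: "x * k = 2 * (10 - k)" using k(1) x_def by (metis nonzero_divide_eq_eq)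
  then have x: "(x + 7) * k = 5 * (k + 4)" "(x + 7 + 5) * k = 10 * (k + 2)"
    by algebra+
  have "(x * (x + 7) * (x + 7 + 5)) * (k^2)^2 = (10 * s)^2" using x0 x assms unfolding k(2) by algebra
  then have "(10 * s / k^2)^2 = x * (x + of_int 7) * (x + of_int 7 + of_int 5)"
    using k(1) by (simp add: power_divide nonzero_divide_eq_eq)
  then have "10 * s / k^2 = 0"
    by (intro no_points_off_two_torsion[OF torsion_classes_only_7_5 _ _ _ concordant_7_5]) auto
  then show ?thesis using k(1) by simp
qed (use assms in auto)

lemma quartic_PQ:
  fixes m s :: rat
  assumes "s^2 = 8 * m * (m + 2) * (m - 3) * (m - 5)"
  shows "s = 0"
proof (cases "m = 0")
  case False
  \<comment> \<open>The roots 0, 3, 5, -2 go to infinity, 0, -8, -50.\<close>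
  define x where "x = - 20 * (m - 3) / m"
  have x0: "x * m = - 20 * (m - 3)" using False x_def by (metis nonzero_divide_eq_eq)
  then have x: "(x + 8) * m = - 12 * (m - 5)" "(x + 8 + 42) * m = 30 * (m + 2)"
    by algebra+
  have "(x * (x + 8) * (x + 8 + 42)) * (m^2)^2 = (30 * s)^2" using x0 x assms by algebra
  then have "(30 * s / m^2)^2 = x * (x + of_int 8) * (x + of_int 8 + of_int 42)"
    using False by (simp add: power_divide nonzero_divide_eq_eq)
  then have "30 * s / m^2 = 0"
    by (intro no_points_off_two_torsion[OF torsion_classes_only_8_42 _ _ _ concordant_8_42]) auto
  then show ?thesis using False by simp
qed (use assms in auto)

section \<open>Independence of the specialized generators\<close>

lemma (in comm_group) generate_pairE:
  assumes "x \<in> carrier G" "y \<in> carrier G" "z \<in> generate G {x, y}"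
  obtains i j :: int where "z = x [^] i \<otimes> y [^] j"
proof -
  have "\<exists>(i::int) (j::int). z = x [^] i \<otimes> y [^] j"
    using assms(3)
  proof (induction rule: generate.induct)
    case one
    have "\<one> = x [^] (0::int) \<otimes> y [^] (0::int)" by simp
    then show ?case by blast
  next
    case (incl h)
    then consider "h = x" | "h = y" by blast
    then show ?case
    proof cases
      case 1
      show ?thesis using assms 1 by (intro exI[of _ "1::int"] exI[of _ "0::int"]) simp
    next
      case 2
      show ?thesis using assms 2 by (intro exI[of _ "0::int"] exI[of _ "1::int"]) simp
    qed
  next
    case (inv h)
    then consider "h = x" | "h = y" by blast
    then show ?case
    proof cases
      case 1
      show ?thesis using assms 1 by (intro exI[of _ "-1::int"] exI[of _ "0::int"]) (simp add: int_pow_neg)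
    next
      case 2
      show ?thesis using assms 2 by (intro exI[of _ "0::int"] exI[of _ "-1::int"]) (simp add: int_pow_neg)
    qed
  next
    case (eng h1 h2)
    then obtain i j k l :: int where "h1 = x [^] i \<otimes> y [^] j" "h2 = x [^] k \<otimes> y [^] l" by blast
    then have "h1 \<otimes> h2 = x [^] (i + k) \<otimes> y [^] (j + l)"
      using assms by (simp add: int_pow_mult m_ac)
    then show ?case by blast
  qed
  then show ?thesis using that by blast
qed

text \<open>A relation can be halved until one of its coefficients is odd; then \<open>x\<close>, \<open>y\<close> or \<open>x \<otimes> y\<close> is a square.\<close>
lemma (in comm_group) independent_pairI:
  fixes i j :: int
  assumes x: "x \<in> carrier G" and y: "y \<in> carrier G"
    and no_two_torsion: "\<And>z. z \<in> carrier G \<Longrightarrow> z \<otimes> z = \<one> \<Longrightarrow> z = \<one>"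
    and not_square: "\<And>z. z \<in> carrier G \<Longrightarrow> z \<otimes> z \<notin> {x, y, x \<otimes> y}"
    and rel: "x [^] i \<otimes> y [^] j = \<one>"
  shows "i = 0 \<and> j = 0"
  using rel
proof (induction "nat (\<bar>i\<bar> + \<bar>j\<bar>)" arbitrary: i j rule: less_induct)
  case less
  define z where "z = x [^] (i div 2) \<otimes> y [^] (j div 2)"
  \<comment> \<open>The remainders are 0 or 1 for negative exponents too, so \<open>r\<close> is the
    unit, \<open>x\<close>, \<open>y\<close> or their product.\<close>
  define r where "r = x [^] (i mod 2) \<otimes> y [^] (j mod 2)"
  have carr: "z \<in> carrier G" "r \<in> carrier G" using x y by (simp_all add: z_def r_def)
  have "x [^] i = x [^] (i div 2) \<otimes> x [^] (i div 2) \<otimes> x [^] (i mod 2)"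
    "y [^] j = y [^] (j div 2) \<otimes> y [^] (j div 2) \<otimes> y [^] (j mod 2)"
    using x y by (simp_all flip: int_pow_mult)
  then have zr: "(z \<otimes> z) \<otimes> r = \<one>"
    using less.prems x y by (simp add: z_def r_def m_ac)
  have "r \<noteq> inv z \<otimes> inv z" if "i mod 2 \<noteq> 0 \<or> j mod 2 \<noteq> 0"
  proof -
    have "i mod 2 \<in> {0, 1}" "j mod 2 \<in> {0, 1}" by auto
    then have "r \<in> {x, y, x \<otimes> y}" using that x y unfolding r_def by auto
    then show ?thesis using not_square[of "inv z"] carr by auto
  qed
  moreover have "r = inv z \<otimes> inv z"
    using zr carr by (metis inv_equality inv_inv inv_mult m_closed m_comm)
  ultimately have even: "i mod 2 = 0" "j mod 2 = 0" by blast+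
  then have "z \<otimes> z = \<one>" using zr carr by (simp add: r_def)
  then have "z = \<one>" using no_two_torsion carr by blast
  show ?case
  proof (rule ccontr)
    assume ne: "\<not> (i = 0 \<and> j = 0)"
    have "nat (\<bar>i div 2\<bar> + \<bar>j div 2\<bar>) < nat (\<bar>i\<bar> + \<bar>j\<bar>)"
    proof -
      obtain i' j' where "i = 2 * i'" "j = 2 * j'" using even by (auto simp: mod_eq_0_iff_dvd elim!: evenE)
      then show ?thesis using ne by (auto simp: abs_mult)
    qed
    then have "i div 2 = 0 \<and> j div 2 = 0"
      by (rule less.hyps) (use \<open>z = \<one>\<close> z_def in simp)
    then show False using even ne by presburger
  qed
qed

text \<open>Here \<open>m\<close> is the slope of the tangent at R. The formulas for doubling
  express both coordinates of R through \<open>m\<close>, \<open>x\<close> and \<open>y\<close>, and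
  the tangent condition becomes the quartic.\<close>

lemma (in elliptic_curve) halving_quartic:
  assumes "on R" "R \<boxplus> R = Pt x y"
  obtains m where "m^4 - 6 * x * m^2 - 8 * y * m - 3 * x^2 - 4 * a = 0"
proof -
  obtain u v where R: "R = Pt u v" using assms(2) by (cases R) auto
  have "\<not> (u = u \<and> v = - v)" using assms(2) unfolding R by (auto split: if_splits)
  then obtain l where l: "is_slope a l u v u v"
    "Pt u v \<boxplus> Pt u v = Pt (l^2 - u - u) (l * (u - (l^2 - u - u)) - v)"
    using add_slopeE assms(1) unfolding R by blast
  have x: "x = l^2 - u - u" and y: "y = l * (u - x) - v" using l(2) assms(2) R by auto
  have "l * (v + v) = u^2 + u * u + u^2 + a" using l(1) by (simp add: is_slope_def)
  then have "l^4 - 6 * x * l^2 - 8 * y * l - 3 * x^2 - 4 * a = 0"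
    unfolding y unfolding x by algebra
  then show ?thesis by (rule that)
qed

theorem theorem4p10:
  fixes t0 :: rat
  assumes "nonsingular (EA0 t0) (EB0 t0)"
    and "t0 \<notin> {-26, -19, -12, -11, -5, -3, -1, 6, 9, 44}"
    and "\<forall>x::rat. x^3 - (t0^2 + 27) * x + 10 * t0^2 + 48 * t0 + 90 \<noteq> 0"
  shows "inj_on (spec t0) M_sub"
proof -
  have ev: "rf_eval EA t0 = EA0 t0" "rf_eval EB t0 = EB0 t0"
    by (simp_all add: EA_def EB_def EA0_def EB0_def regular_rf power2_eq_square algebra_simps)
  interpret specialization t0 EA EB
  proof
    show "\<not> has_pole EA t0" "\<not> has_pole EB t0" by (simp_all add: EA_def EB_def regular_rf)
    show "nonsingular (rf_eval EA t0) (rf_eval EB t0)" using assms(1) by (simp add: ev)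
    show "x^3 + rf_eval EA t0 * x + rf_eval EB t0 \<noteq> 0" for x
      using assms(3)[rule_format, of x] by (simp add: ev EA0_def EB0_def algebra_simps)
  qed
  define H where "H = ec_group (EA0 t0) (EB0 t0)"
  interpret G: comm_group E_group
    unfolding E_group_def by (rule F.comm_group_ec_group)
  interpret H: comm_group H
    unfolding H_def using K.comm_group_ec_group by (simp add: ev)
  interpret sp: group_hom E_group H "spec t0"
    by unfold_locales (use spec_hom in \<open>simp add: E_group_def H_def ev\<close>)
  define P0 Q0 where "P0 = Pt (t0 + 3) (4 * t0 + 6)" and "Q0 = Pt 9 (t0 + 24)"
  have carr_iff: "A \<in> carrier E_group \<longleftrightarrow> F.on A" "B \<in> carrier H \<longleftrightarrow> K.on B" for A B
    by (simp_all add: E_group_def H_def ec_group_def ec_points_def ev)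
  have mult: "A \<otimes>\<^bsub>H\<^esub> B = K.add A B" for A B by (simp add: H_def ec_group_def ev)
  have one: "\<one>\<^bsub>H\<^esub> = Infty" by (simp add: H_def ec_group_def)
  have PQ: "P_pt \<in> carrier E_group" "Q_pt \<in> carrier E_group"
    unfolding carr_iff P_pt_def Q_pt_def on_curve_def ecpt.case EA_def EB_def rf_def power2_eq_square power3_eq_cube
    by (simp_all flip: to_fract_add to_fract_mult)
  have sPQ: "spec t0 P_pt = P0" "spec t0 Q_pt = Q0"
    by (simp_all add: P_pt_def Q_pt_def spec_def regular_rf P0_def Q0_def algebra_simps)
  have carr: "P0 \<in> carrier H" "Q0 \<in> carrier H" using sp.hom_closed PQ sPQ by metis+
  have sum: "P0 \<otimes>\<^bsub>H\<^esub> Q0 = Pt (- t0 - 3) (2 * t0 + 12)"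
    unfolding mult P0_def Q0_def
  proof (rule K.add_eq)
    show "K.on (Pt (t0 + 3) (4 * t0 + 6))" "K.on (Pt 9 (t0 + 24))"
      using carr unfolding carr_iff P0_def Q0_def by simp_all
    show "\<not> (t0 + 3 = 9 \<and> 4 * t0 + 6 = - (t0 + 24))" using assms(2) by auto
    \<comment> \<open>The difference of the ordinates is \<open>3 * t0 - 18\<close>, three times
      that of the abscissas, so the slope is constant.\<close>
    show "is_slope (rf_eval EA t0) 3 (t0 + 3) (4 * t0 + 6) 9 (t0 + 24)"
      by (simp add: is_slope_def ev EA0_def power2_eq_square algebra_simps)
  qed (simp_all add: algebra_simps)
  have "i = 0 \<and> j = 0" if "P0 [^]\<^bsub>H\<^esub> i \<otimes>\<^bsub>H\<^esub> Q0 [^]\<^bsub>H\<^esub> j = \<one>\<^bsub>H\<^esub>" for i j :: int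
  proof (rule H.independent_pairI[OF carr _ _ that])
    fix R assume R: "R \<in> carrier H" "R \<otimes>\<^bsub>H\<^esub> R = \<one>\<^bsub>H\<^esub>"
    show "R = \<one>\<^bsub>H\<^esub>"
    proof (cases R)
      case (Pt x y)
      then have "y = - y" using R(2) unfolding mult one ec_add_eq_Infty_iff by simp
      then show ?thesis using y_nonzero[of x y] R(1) Pt unfolding carr_iff by simp
    qed (simp add: one)
  next
    fix R assume "R \<in> carrier H"
    then have R: "K.on R" by (simp add: carr_iff)
    show "R \<otimes>\<^bsub>H\<^esub> R \<notin> {P0, Q0, P0 \<otimes>\<^bsub>H\<^esub> Q0}"
    proof
      assume "R \<otimes>\<^bsub>H\<^esub> R \<in> {P0, Q0, P0 \<otimes>\<^bsub>H\<^esub> Q0}"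
      then consider "K.add R R = Pt (t0 + 3) (4 * t0 + 6)" | "K.add R R = Pt 9 (t0 + 24)"
        | "K.add R R = Pt (- t0 - 3) (2 * t0 + 12)"
        unfolding sum unfolding mult P0_def Q0_def by blast
      then show False
      proof cases
        case 1
        obtain m where "m^4 - 6 * (t0 + 3) * m^2 - 8 * (4 * t0 + 6) * m - 3 * (t0 + 3)^2 - 4 * EA0 t0 = 0"
          using K.halving_quartic[OF R 1] unfolding ev by blast
        \<comment> \<open>The quartic in \<open>m\<close> is a monic quadratic in \<open>t0\<close>;
          completing the square leaves a quarter of its discriminant on the right.\<close>
        then have *: "(t0 - (3 * m^2 + 16 * m + 9))^2 = 8 * m * (m + 2) * (m + 3) * (m + 7)"
          unfolding EA0_def by algebra
        then have t0: "t0 = 3 * m^2 + 16 * m + 9" using quartic_P by fastforce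
        \<comment> \<open>These roots give \<open>t0\<close> = 9, -11, -12, 44.\<close>
        then have "m = 0 \<or> m = - 2 \<or> m = - 3 \<or> m = - 7" using * by auto
        then show False using t0 assms(2) by auto
      next
        case 2
        obtain m where "m^4 - 6 * 9 * m^2 - 8 * (t0 + 24) * m - 3 * 9^2 - 4 * EA0 t0 = 0"
          using K.halving_quartic[OF R 2] unfolding ev by blast
        then have *: "(2 * t0 - 2 * m)^2 = - ((m + 1) * (m + 3) * (m + 5) * (m - 9))"
          unfolding EA0_def by algebra
        then have t0: "t0 = m" using quartic_Q by fastforce
        then have "m = - 1 \<or> m = - 3 \<or> m = - 5 \<or> m = 9" using * by auto
        then show False using t0 assms(2) by auto
      next
        case 3
        obtain m where "m^4 - 6 * (- t0 - 3) * m^2 - 8 * (2 * t0 + 12) * m - 3 * (- t0 - 3)^2 - 4 * EA0 t0 = 0"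
          using K.halving_quartic[OF R 3] unfolding ev by blast
        then have *: "(t0 + (3 * m^2 - 8 * m - 9))^2 = 8 * m * (m + 2) * (m - 3) * (m - 5)"
          unfolding EA0_def by algebra
        then have t0: "t0 = - (3 * m^2 - 8 * m - 9)" using quartic_PQ by fastforce
        \<comment> \<open>These roots give \<open>t0\<close> = 9, -19, 6, -26.\<close>
        then have "m = 0 \<or> m = - 2 \<or> m = 3 \<or> m = 5" using * by auto
        then show False using t0 assms(2) by auto
      qed
    qed
  qed
  note independent = this
  show ?thesis
  proof (rule inj_onI)
    fix A B assume "A \<in> M_sub" "B \<in> M_sub" and eq: "spec t0 A = spec t0 B"
    then obtain i j k l :: int
      where A: "A = P_pt [^]\<^bsub>E_group\<^esub> i \<otimes>\<^bsub>E_group\<^esub> Q_pt [^]\<^bsub>E_group\<^esub> j"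
        and B: "B = P_pt [^]\<^bsub>E_group\<^esub> k \<otimes>\<^bsub>E_group\<^esub> Q_pt [^]\<^bsub>E_group\<^esub> l"
      unfolding M_sub_def using G.generate_pairE[OF PQ] by metis
    have e: "P0 [^]\<^bsub>H\<^esub> i \<otimes>\<^bsub>H\<^esub> Q0 [^]\<^bsub>H\<^esub> j = P0 [^]\<^bsub>H\<^esub> k \<otimes>\<^bsub>H\<^esub> Q0 [^]\<^bsub>H\<^esub> l"
      using eq PQ by (simp add: A B sp.hom_int_pow sPQ)
    have "P0 [^]\<^bsub>H\<^esub> (i - k) \<otimes>\<^bsub>H\<^esub> Q0 [^]\<^bsub>H\<^esub> (j - l) =
      (P0 [^]\<^bsub>H\<^esub> i \<otimes>\<^bsub>H\<^esub> Q0 [^]\<^bsub>H\<^esub> j) \<otimes>\<^bsub>H\<^esub> inv\<^bsub>H\<^esub> (P0 [^]\<^bsub>H\<^esub> k \<otimes>\<^bsub>H\<^esub> Q0 [^]\<^bsub>H\<^esub> l)"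
      using carr by (simp add: H.int_pow_diff H.inv_mult H.m_ac)
    also have "\<dots> = \<one>\<^bsub>H\<^esub>" unfolding e using carr by simp
    finally have "i - k = 0 \<and> j - l = 0" by (rule independent)
    then show "A = B" by (simp add: A B)
  qed
qed

end
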